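(* Let $G$ be a claw-free graph that is not quasi-line, with $\alpha(G)=3$. If $G$ is facet-defining, then $G$ is ${\rm LS}_+$-imperfect.
   Context: All graphs are finite and simple; $\alpha(G)$ is the stability number. A graph is claw-free if it has no induced $K_{1,3}$; it is quasi-line if the neighborhood of every node can be partitioned into two cliques. ${\rm STAB}(G)$ is the convex hull of incidence vectors of stable sets of $G=(V,E)$; $G$ is facet-defining if ${\rm STAB}(G)$ has a facet with all left-hand-side coefficients nonzero. ${\rm ESTAB}(G)=\{x\in[0,1]^V: x_i+x_j\le1,\ ij\in E\}$. For convex $K\subseteq[0,1]^n$: $\mathrm{cone}(K)=\{(x_0,x): x=x_0y, y\in K\}$; $M_+(K)$ is the set of symmetric positive semidefinite $(n+1)\times(n+1)$ matrices $Y$ (indices $0,\dots,n$) with $Ye_0=\mathrm{diag}(Y)$, $Ye_i\in\mathrm{cone}(K)$, $Y(e_0-e_i)\in\mathrm{cone}(K)$ for $i=1,\dots,n$; ${\rm LS}_+(K)=\{x\in[0,1]^n:(1,x)^T=Ye_0 \text{ for some } Y\in M_+(K)\}$. $G$ is ${\rm LS}_+$-perfect if ${\rm LS}_+({\rm ESTAB}(G))={\rm STAB}(G)$, and ${\rm LS}_+$-imperfect otherwise. *)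

theory Defs
  imports "HOL-Analysis.Analysis"
begin

definition simple_graph :: "('n::finite \<Rightarrow> 'n \<Rightarrow> bool) \<Rightarrow> bool" where
  "simple_graph E \<longleftrightarrow> (\<forall>i j. E i j \<longrightarrow> E j i) \<and> (\<forall>i. \<not> E i i)"

definition stable_set :: "('n::finite \<Rightarrow> 'n \<Rightarrow> bool) \<Rightarrow> 'n set \<Rightarrow> bool" where
  "stable_set E S \<longleftrightarrow> (\<forall>i\<in>S. \<forall>j\<in>S. \<not> E i j)"

definition clique :: "('n::finite \<Rightarrow> 'n \<Rightarrow> bool) \<Rightarrow> 'n set \<Rightarrow> bool" where
  "clique E S \<longleftrightarrow> (\<forall>i\<in>S. \<forall>j\<in>S. i \<noteq> j \<longrightarrow> E i j)"

definition stability_number :: "('n::finite \<Rightarrow> 'n \<Rightarrow> bool) \<Rightarrow> nat" where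
  "stability_number E = Max {card S | S. stable_set E S}"

definition claw_free :: "('n::finite \<Rightarrow> 'n \<Rightarrow> bool) \<Rightarrow> bool" where
  "claw_free E \<longleftrightarrow> \<not> (\<exists>c a b d. a \<noteq> b \<and> a \<noteq> d \<and> b \<noteq> d \<and>
      E c a \<and> E c b \<and> E c d \<and> \<not> E a b \<and> \<not> E a d \<and> \<not> E b d)"

definition neighborhood :: "('n::finite \<Rightarrow> 'n \<Rightarrow> bool) \<Rightarrow> 'n \<Rightarrow> 'n set" where
  "neighborhood E v = {u. E v u}"

definition quasi_line :: "('n::finite \<Rightarrow> 'n \<Rightarrow> bool) \<Rightarrow> bool" where
  "quasi_line E \<longleftrightarrow> (\<forall>v. \<exists>A B. A \<union> B = neighborhood E v \<and> A \<inter> B = {} \<and>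
      clique E A \<and> clique E B)"

definition incidence_vector :: "'n::finite set \<Rightarrow> real^'n" where
  "incidence_vector S = (\<chi> i. if i \<in> S then 1 else 0)"

definition STAB :: "('n::finite \<Rightarrow> 'n \<Rightarrow> bool) \<Rightarrow> (real^'n) set" where
  "STAB E = convex hull {incidence_vector S | S. stable_set E S}"

definition ESTAB :: "('n::finite \<Rightarrow> 'n \<Rightarrow> bool) \<Rightarrow> (real^'n) set" where
  "ESTAB E = {x. (\<forall>i. 0 \<le> x$i \<and> x$i \<le> 1) \<and> (\<forall>i j. E i j \<longrightarrow> x$i + x$j \<le> 1)}"

definition facet_defining :: "('n::finite \<Rightarrow> 'n \<Rightarrow> bool) \<Rightarrow> bool" where
  "facet_defining E \<longleftrightarrow> (\<exists>(a::real^'n) (b::real). (\<forall>i. a$i \<noteq> 0) \<and>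
      (\<forall>x\<in>STAB E. a \<bullet> x \<le> b) \<and> (STAB E \<inter> {x. a \<bullet> x = b}) facet_of STAB E)"

definition in_cone :: "(real^'n::finite) set \<Rightarrow> real \<Rightarrow> real^'n \<Rightarrow> bool" where
  "in_cone K x0 x \<longleftrightarrow> (\<exists>y\<in>K. x = x0 *\<^sub>R y)"

text \<open>(n+1)x(n+1) matrices indexed by 'n option; None plays the role of index 0.
  For a vector v indexed by 'n option, split v into (v_0, (v_i)_i).\<close>
definition vhead :: "('n::finite option \<Rightarrow> real) \<Rightarrow> real" where
  "vhead v = v None"
definition vtail :: "('n::finite option \<Rightarrow> real) \<Rightarrow> real^'n" where
  "vtail v = (\<chi> i. v (Some i))"

definition psd :: "('n::finite option \<Rightarrow> 'n option \<Rightarrow> real) \<Rightarrow> bool" where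
  "psd Y \<longleftrightarrow> (\<forall>i j. Y i j = Y j i) \<and>
     (\<forall>v. 0 \<le> (\<Sum>i\<in>UNIV. \<Sum>j\<in>UNIV. v i * Y i j * v j))"

definition M_plus :: "(real^'n::finite) set \<Rightarrow> ('n option \<Rightarrow> 'n option \<Rightarrow> real) set" where
  "M_plus K = {Y. psd Y \<and> (\<forall>j. Y j None = Y j j) \<and>
     (\<forall>i. in_cone K (vhead (\<lambda>j. Y j (Some i))) (vtail (\<lambda>j. Y j (Some i)))) \<and>
     (\<forall>i. in_cone K (vhead (\<lambda>j. Y j None - Y j (Some i))) (vtail (\<lambda>j. Y j None - Y j (Some i))))}"

definition LS_plus :: "(real^'n::finite) set \<Rightarrow> (real^'n) set" where
  "LS_plus K = {x. (\<forall>i. 0 \<le> x$i \<and> x$i \<le> 1) \<and>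
     (\<exists>Y\<in>M_plus K. Y None None = 1 \<and> (\<forall>i. Y (Some i) None = x$i))}"

definition LS_plus_perfect :: "('n::finite \<Rightarrow> 'n \<Rightarrow> bool) \<Rightarrow> bool" where
  "LS_plus_perfect E \<longleftrightarrow> LS_plus (ESTAB E) = STAB E"

end

theory Submission
  imports Defs
begin

section \<open>Claw-free graphs that are not quasi-line\<close>

text \<open>Suppose \<open>E\<close> is \<open>LS_plus\<close>-perfect.  Explicit positive semidefinite matrices show that three small
  graphs violate their rank inequality under \<open>LS_plus\<close>, so none of them is an induced subgraph of
  \<open>E\<close>: a 5-hole with a vertex seeing three consecutive or four of its vertices, and two triangles
  linked by an edge and by two paths of length two.  A neighbourhood that is not the union of two
  cliques contains an odd antihole; with stability number 3, an odd antihole of length at least 7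
  forces one of the first two graphs, so there is a 5-wheel with hub \<open>z\<close> and rim \<open>c1\<close>, ..., \<open>c5\<close>.
  Every other vertex then sees all of the rim, exactly two consecutive vertices of it, or none, and
  \<open>E\<close> becomes a blow-up of an induced subgraph of the icosahedron.  If this subgraph is large, it
  contains the linked triangles; otherwise it has a clique cutset or consists of two or three
  intersecting 5-wheels.  The latter graphs have only clique and wheel facets besides the
  nonnegativity constraints, and these do not have full support.\<close>

subsection \<open>Certificates for \<open>LS_plus\<close>-imperfection\<close>

text \<open>Clique, wheel and odd antihole inequalities are valid for
  \<open>LS_plus (ESTAB E)\<close> for every graph, so the 5-wheel that is found cannot be refuted
  by a certificate of its own; the facet must help. It is used only through its tight stable sets:
  no nonzero functional with a zero coordinate is constant on them. This yields positive
  coefficients, excludes clique cutsets, and replaces complete descriptions of the last polytopes by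
  a few linear inequalities. Stability number 3 acts in both directions. A stable triple shows that
  the graph is more than an antihole or a wheel, which have stability number 2; the lack of a stable
  quadruple joins vertices that miss the rim to those attached to a rim edge. The icosahedron has
  \<open>z\<close> and the vertices missing the rim as opposite poles; the rim and the classes of
  vertices seeing two consecutive rim vertices are the two pentagons.\<close>

lemma in_cone_ESTAB:
  fixes x :: "real^'n::finite"
  assumes "\<And>i. 0 \<le> x $ i" and "\<And>i. x $ i \<le> r"
    and "\<And>i j. E i j \<Longrightarrow> x $ i + x $ j \<le> r"
  shows "in_cone (ESTAB E) r x"
proof -
  have "0 \<le> r"
    using assms(1)[of undefined] assms(2)[of undefined] by linarith
  show ?thesis
  \<comment> \<open>Scaling by \<open>1 / r\<close> fails at \<open>r = 0\<close>; there the bounds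
    force \<open>x = 0\<close>, a multiple of the origin of \<open>ESTAB\<close>.\<close>
  proof (cases "r = 0")
    case True
    then have "x = r *\<^sub>R 0"
      using assms(1,2) by (simp add: vec_eq_iff) (metis order_antisym)
    moreover have "0 \<in> ESTAB E"
      by (simp add: ESTAB_def)
    ultimately show ?thesis
      unfolding in_cone_def by blast
  next
    case False
    with \<open>0 \<le> r\<close> have "0 < r" by simp
    then have "(1 / r) *\<^sub>R x \<in> ESTAB E"
      using assms by (simp add: ESTAB_def field_simps)
    moreover have "x = r *\<^sub>R ((1 / r) *\<^sub>R x)"
      using \<open>0 < r\<close> by simp
    ultimately show ?thesis
      unfolding in_cone_def by blast
  qed
qed

lemma STAB_rank_le:
  fixes x :: "real^'n::finite"
  assumes "x \<in> STAB E" and "\<And>S. stable_set E S \<Longrightarrow> card (S \<inter> U) \<le> k"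
  shows "(\<Sum>i\<in>U. x $ i) \<le> real k"
proof -
  let ?H = "{x :: real^'n. (\<chi> i. if i \<in> U then 1 else 0) \<bullet> x \<le> real k}"
  have inner: "(\<chi> i. if i \<in> U then 1 else 0) \<bullet> x = (\<Sum>i\<in>U. x $ i)" for x :: "real^'n"
    by (simp add: inner_vec_def if_distrib[of "\<lambda>c. c * _"] sum.If_cases cong: if_cong)
  have "{incidence_vector S | S. stable_set E S} \<subseteq> ?H"
    using assms(2)
    by (auto simp: inner incidence_vector_def sum.If_cases Int_commute)
  moreover have "convex ?H"
    by (rule convex_halfspace_le)
  ultimately have "STAB E \<subseteq> ?H"
    unfolding STAB_def by (rule hull_minimal)
  with assms(1) show ?thesis
    by (auto simp: inner)
qed

lemma filter_in_subseqs: "filter P xs \<in> set (subseqs xs)"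
  by (induction xs) (auto simp: Let_def)

text \<open>An \<open>int\<close>-valued certificate that the rank inequality \<open>x(V) \<le> b\<close> is valid for the stable set
  polytope, but not for \<open>LS_plus\<close>, of the graph on \<open>{0..<m}\<close> with edge list \<open>es\<close>.  The matrix
  \<open>T\<close> is a member of \<open>M_plus\<close> scaled by \<open>T ! 0 ! 0\<close>, with vertex \<open>k\<close> at index \<open>Suc k\<close>, and \<open>R\<close>
  lists the weighted squares of an \<open>LDL\<close> decomposition of \<open>c * T\<close>.  The instances below are rational
  roundings of near-optimal numerical solutions of the semidefinite program.\<close>
definition rank_violation ::
  "nat \<Rightarrow> (nat \<times> nat) list \<Rightarrow> nat \<Rightarrow> int list list \<Rightarrow> int \<Rightarrow> (int \<times> int list) list \<Rightarrow> bool" where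
  "rank_violation m es b T c R \<longleftrightarrow>
     0 < c \<and> 0 < T ! 0 ! 0 \<and> (\<forall>(d, u)\<in>set R. 0 \<le> d) \<and>
     (\<forall>i\<in>set [0..<Suc m]. T ! i ! 0 = T ! i ! i \<and> (\<forall>j\<in>set [0..<Suc m].
        c * T ! i ! j = (\<Sum>(d, u)\<leftarrow>R. d * u ! i * u ! j) \<and>
        0 \<le> T ! i ! j \<and> T ! i ! j \<le> T ! i ! i \<and> T ! i ! i + T ! j ! j \<le> T ! 0 ! 0 + T ! i ! j)) \<and>
     (\<forall>(k, l)\<in>set es. \<forall>i\<in>set [0..<Suc m].
        T ! Suc k ! i + T ! Suc l ! i \<le> T ! i ! i \<and>
        T ! Suc k ! Suc k + T ! Suc l ! Suc l - T ! Suc k ! i - T ! Suc l ! i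
          \<le> (if i = 0 then 0 else T ! 0 ! 0 - T ! i ! i)) \<and>
     int b * T ! 0 ! 0 < (\<Sum>k\<leftarrow>[0..<m]. T ! Suc k ! 0) \<and>
     (\<forall>xs\<in>set (subseqs [0..<m]). b < length xs \<longrightarrow>
        (\<exists>(k, l)\<in>set es. k \<in> set xs \<and> l \<in> set xs))"

text \<open>Imperfection is inherited from an induced subgraph: extended by zero rows and columns,
  the certified matrix stays positive semidefinite and in \<open>M_plus\<close>, and its first
  column violates the rank inequality on \<open>ps\<close>.\<close>

theorem not_LS_plus_perfect_if_rank_violation:
  fixes E :: "'n::finite \<Rightarrow> 'n \<Rightarrow> bool"
  assumes cert: "rank_violation m es b T c R"
    and ps: "distinct ps" "length ps = m"
    and adj: "\<And>k l. k < m \<Longrightarrow> l < m \<Longrightarrow> E (ps ! k) (ps ! l) \<longleftrightarrow> (k, l) \<in> set es \<or> (l, k) \<in> set es"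
  shows "\<not> LS_plus_perfect E"
proof -
  define t where "t i j = (if i \<le> m \<and> j \<le> m then T ! i ! j else 0)" for i j
  define w where "w u i = (if i \<le> m then u ! i else 0)" for u :: "int list" and i
  define N where "N = T ! 0 ! 0"
  \<comment> \<open>All vertices outside \<open>ps\<close> share the index \<open>Suc m\<close>,
    where \<open>t\<close> is zero, so one formula for \<open>Y\<close> covers every vertex.\<close>
  define idx where "idx v = (case v of None \<Rightarrow> 0 | Some x \<Rightarrow>
      if x \<in> set ps then Suc (THE k. k < m \<and> ps ! k = x) else Suc m)" for v
  have idx_ps: "idx (Some (ps ! k)) = Suc k" if "k < m" for k
    using that ps by (auto simp: idx_def nth_eq_iff_index_eq)
  have idx_None: "idx None = 0"
    by (simp add: idx_def)
  have idx_Some: "(\<exists>k<m. x = ps ! k \<and> idx (Some x) = Suc k) \<or> x \<notin> set ps \<and> idx (Some x) = Suc m" for x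
  proof (cases "x \<in> set ps")
    case True
    then obtain k where "k < m" "x = ps ! k"
      using ps(2) by (auto simp: in_set_conv_nth)
    then show ?thesis
      using idx_ps by blast
  next
    case False
    then show ?thesis
      by (simp add: idx_def)
  qed
  have c: "0 < c" and N: "0 < N" and R: "\<And>d u. (d, u) \<in> set R \<Longrightarrow> 0 \<le> d"
    using cert unfolding rank_violation_def N_def by - (elim conjE; blast)+
  have le_m: "i \<in> set [0..<Suc m]" if "i \<le> m" for i
    using that by auto
  have vertices: "\<forall>i\<in>set [0..<Suc m]. T ! i ! 0 = T ! i ! i \<and> (\<forall>j\<in>set [0..<Suc m].
        c * T ! i ! j = (\<Sum>(d, u)\<leftarrow>R. d * u ! i * u ! j) \<and>
        0 \<le> T ! i ! j \<and> T ! i ! j \<le> T ! i ! i \<and> T ! i ! i + T ! j ! j \<le> N + T ! i ! j)"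
    and edges: "\<forall>(k, l)\<in>set es. \<forall>i\<in>set [0..<Suc m].
        T ! Suc k ! i + T ! Suc l ! i \<le> T ! i ! i \<and>
        T ! Suc k ! Suc k + T ! Suc l ! Suc l - T ! Suc k ! i - T ! Suc l ! i
          \<le> (if i = 0 then 0 else N - T ! i ! i)"
    using cert unfolding rank_violation_def N_def by - (elim conjE, assumption)+
  have T_diag: "T ! i ! 0 = T ! i ! i" if "i \<le> m" for i
    using bspec[OF vertices le_m[OF that]] by (rule conjunct1)
  have T_gram: "c * T ! i ! j = (\<Sum>(d, u)\<leftarrow>R. d * u ! i * u ! j)"
    and T_bounds: "0 \<le> T ! i ! j" "T ! i ! j \<le> T ! i ! i" "T ! i ! i + T ! j ! j \<le> N + T ! i ! j"
    if "i \<le> m" "j \<le> m" for i j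
    using bspec[OF conjunct2[OF bspec[OF vertices le_m[OF that(1)]]] le_m[OF that(2)]]
    by - (elim conjE, assumption)+
  have T_edge: "T ! Suc k ! i + T ! Suc l ! i \<le> T ! i ! i"
    "T ! Suc k ! Suc k + T ! Suc l ! Suc l - T ! Suc k ! i - T ! Suc l ! i
      \<le> (if i = 0 then 0 else N - T ! i ! i)"
    if "(k, l) \<in> set es" "i \<le> m" for k l i
    using bspec[OF bspec[OF edges that(1), unfolded prod.case] le_m[OF that(2)]]
    by - (elim conjE, assumption)+
  have T_sum: "int b * N < (\<Sum>k\<leftarrow>[0..<m]. T ! Suc k ! 0)"
    using cert unfolding rank_violation_def N_def by (elim conjE)
  have rank: "\<exists>(k, l)\<in>set es. k \<in> set xs \<and> l \<in> set xs"
    if "xs \<in> set (subseqs [0..<m])" "b < length xs" for xs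
  proof -
    have "\<forall>xs\<in>set (subseqs [0..<m]). b < length xs \<longrightarrow>
        (\<exists>(k, l)\<in>set es. k \<in> set xs \<and> l \<in> set xs)"
      using cert unfolding rank_violation_def by (elim conjE)
    then show ?thesis
      using that by blast
  qed
  have gram: "c * t i j = (\<Sum>(d, u)\<leftarrow>R. d * w u i * w u j)" for i j
  proof (cases "i \<le> m \<and> j \<le> m")
    case True
    then show ?thesis
      using T_gram[of i j] by (simp add: t_def w_def)
  next
    case False
    have "(\<Sum>(d, u)\<leftarrow>L. d * w u i * w u j) = 0" for L
      using False by (induction L) (auto simp: w_def)
    then show ?thesis
      using False by (auto simp: t_def)
  qed
  have sym: "t i j = t j i" for i j
  proof -
    have "c * t i j = c * t j i"
      unfolding gram by (simp add: mult_ac)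
    then show ?thesis using c by simp
  qed
  have diag: "t i 0 = t i i" and nonneg: "0 \<le> t i j" and le_diag: "t i j \<le> t i i" for i j
    using T_diag T_bounds by (auto simp: t_def)
  have t00: "t 0 0 = N"
    by (simp add: t_def N_def)
  have supermod: "t i i + t j j \<le> N + t i j" for i j
  proof (cases "i \<le> m \<and> j \<le> m")
    case True
    then show ?thesis
      using T_bounds by (simp add: t_def)
  next
    case False
    have "t i i \<le> N" for i
      using le_diag[of 0 i] sym[of 0 i] diag[of i] t00 by simp
    moreover have "t i i = 0 \<and> t i j = 0 \<or> t j j = 0 \<and> t i j = 0"
      using False by (auto simp: t_def)
    ultimately show ?thesis
      by (metis add.commute add.right_neutral)
  qed
  \<comment> \<open>The edge constraints of \<open>ESTAB\<close>, homogenized: \<open>edge\<close>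
    for column \<open>i\<close>, \<open>co_edge\<close> for column 0 minus column
    \<open>i\<close>.\<close>
  have edge: "t (idx (Some x)) i + t (idx (Some y)) i \<le> t i i"
    and co_edge: "i \<noteq> 0 \<Longrightarrow> t (idx (Some x)) 0 + t (idx (Some y)) 0
        - t (idx (Some x)) i - t (idx (Some y)) i \<le> N - t i i"
    if "E x y" for x y i
  proof -
    have "t (idx (Some x)) i + t (idx (Some y)) i \<le> t i i \<and> (i \<noteq> 0 \<longrightarrow>
      t (idx (Some x)) 0 + t (idx (Some y)) 0 - t (idx (Some x)) i - t (idx (Some y)) i \<le> N - t i i)"
    proof (cases "x \<in> set ps \<and> y \<in> set ps")
      case True
      then obtain k l where kl: "k < m" "l < m" "x = ps ! k" "y = ps ! l"
        using ps(2) by (metis in_set_conv_nth)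
      then have "(k, l) \<in> set es \<or> (l, k) \<in> set es"
        using adj that by auto
      then have *: "t (Suc k) i + t (Suc l) i \<le> t i i \<and> (i \<noteq> 0 \<longrightarrow>
          t (Suc k) (Suc k) + t (Suc l) (Suc l) - t (Suc k) i - t (Suc l) i \<le> N - t i i)"
        if "i \<le> m" for i
        using T_edge[of k l i] T_edge[of l k i] kl(1,2) that by (auto simp: t_def)
      show ?thesis
      proof (cases "i \<le> m")
        case True
        then show ?thesis
          using * kl idx_ps diag by simp
      next
        case False
        then have "t j i = 0" "t i i = 0" for j
          by (auto simp: t_def)
        moreover have "t (Suc k) 0 + t (Suc l) 0 \<le> N"
          using *[of 0] t00 by simp
        ultimately show ?thesis
          using kl idx_ps by simp
      qed
    next
      case False
      then have "(\<forall>j. t (idx (Some x)) j = 0) \<or> (\<forall>j. t (idx (Some y)) j = 0)"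
        using idx_Some[of x] idx_Some[of y] nth_mem[of _ ps] ps(2) by (fastforce simp: t_def)
      moreover have "t j i \<le> t i i" "t j 0 - t j i \<le> N - t i i" "0 \<le> N - t i i" for j
        using le_diag[of i j] sym[of i j] supermod[of j i] diag[of j] diag[of i]
          le_diag[of 0 i] sym[of 0 i] t00 by auto
      ultimately show ?thesis
        by (metis add.left_neutral add.right_neutral diff_zero)
    qed
    then show "t (idx (Some x)) i + t (idx (Some y)) i \<le> t i i"
      and "i \<noteq> 0 \<Longrightarrow> t (idx (Some x)) 0 + t (idx (Some y)) 0
        - t (idx (Some x)) i - t (idx (Some y)) i \<le> N - t i i"
      by auto
  qed
  define Y where "Y i j = real_of_int (t (idx i) (idx j)) / real_of_int N" for i j
  define x where "x = (\<chi> i. Y (Some i) None)"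
  have frac_le: "real_of_int a / real_of_int N + real_of_int b / real_of_int N \<le> real_of_int d / real_of_int N"
    if "a + b \<le> d" for a b d
    using N that by (simp add: add_divide_distrib[symmetric] divide_right_mono del: of_int_add add: of_int_add[symmetric])
  have "psd Y"
    unfolding psd_def
  proof (intro conjI allI)
    show "Y i j = Y j i" for i j
      by (simp add: Y_def sym)
    fix v :: "'n option \<Rightarrow> real"
    have square: "(\<Sum>i\<in>UNIV. \<Sum>j\<in>UNIV. v i * (\<Sum>(d, u)\<leftarrow>L. d * w u (idx i) * w u (idx j)) * v j)
        = (\<Sum>(d, u)\<leftarrow>L. d * (\<Sum>i\<in>UNIV. v i * w u (idx i))\<^sup>2)" for L
    proof (induction L)
      case Nil
      then show ?case by simp
    next
      case (Cons r L)
      obtain d u where r: "r = (d, u)" by (cases r)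
      have "(\<Sum>i\<in>UNIV. \<Sum>j\<in>UNIV. v i * (d * w u (idx i) * w u (idx j)) * v j)
          = d * (\<Sum>i\<in>UNIV. v i * w u (idx i))\<^sup>2"
        by (simp add: power2_eq_square sum_product sum_distrib_left mult_ac)
      with Cons.IH show ?case
        by (simp add: r distrib_left distrib_right sum.distrib)
    qed
    have "(real_of_int c * real_of_int N) * (\<Sum>i\<in>UNIV. \<Sum>j\<in>UNIV. v i * Y i j * v j)
        = (\<Sum>i\<in>UNIV. \<Sum>j\<in>UNIV. v i * real_of_int (c * t (idx i) (idx j)) * v j)"
      using N by (simp add: Y_def sum_distrib_left mult_ac)
    also have "\<dots> = (\<Sum>(d, u)\<leftarrow>R. d * (\<Sum>i\<in>UNIV. v i * w u (idx i))\<^sup>2)"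
    proof -
      have "real_of_int (\<Sum>(d, u)\<leftarrow>L. d * w u a * w u b)
          = (\<Sum>(d, u)\<leftarrow>L. real_of_int d * w u a * w u b)" for L a b
        by (induction L) auto
      then show ?thesis
        unfolding gram square[symmetric] by simp
    qed
    also have "\<dots> \<ge> 0"
      using R by (auto intro!: sum_list_nonneg)
    finally show "0 \<le> (\<Sum>i\<in>UNIV. \<Sum>j\<in>UNIV. v i * Y i j * v j)"
      using c N by (simp add: zero_le_mult_iff mult_le_0_iff)
  qed
  moreover have "Y j None = Y j j" for j
    by (simp add: Y_def idx_None diag)
  moreover have "in_cone (ESTAB E) (vhead (\<lambda>j. Y j (Some i))) (vtail (\<lambda>j. Y j (Some i)))" for i
  proof (rule in_cone_ESTAB)
    fix j k
    show "0 \<le> vtail (\<lambda>j. Y j (Some i)) $ j"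
      using N by (simp add: vtail_def Y_def nonneg)
    have "t (idx (Some j)) (idx (Some i)) \<le> t 0 (idx (Some i))"
      using le_diag[of "idx (Some i)" "idx (Some j)"] diag sym by metis
    then show "vtail (\<lambda>j. Y j (Some i)) $ j \<le> vhead (\<lambda>j. Y j (Some i))"
      using N by (simp add: vtail_def vhead_def Y_def idx_None divide_right_mono)
    assume "E j k"
    then show "vtail (\<lambda>j. Y j (Some i)) $ j + vtail (\<lambda>j. Y j (Some i)) $ k \<le> vhead (\<lambda>j. Y j (Some i))"
      using frac_le[OF edge[of j k "idx (Some i)"]] diag[of "idx (Some i)"] sym[of 0 "idx (Some i)"]
      by (simp add: vtail_def vhead_def Y_def idx_None)
  qed
  moreover have "in_cone (ESTAB E) (vhead (\<lambda>j. Y j None - Y j (Some i))) (vtail (\<lambda>j. Y j None - Y j (Some i)))" for i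
  proof (rule in_cone_ESTAB)
    let ?i = "idx (Some i)"
    have i: "?i \<noteq> 0"
      using idx_Some[of i] by auto
    have div: "real_of_int a / real_of_int N \<le> real_of_int d / real_of_int N" if "a \<le> d" for a d
      using N that by (simp add: divide_right_mono)
    have Y: "Y j None - Y j (Some i) = real_of_int (t (idx j) 0 - t (idx j) ?i) / real_of_int N" for j
      by (simp add: Y_def idx_None diff_divide_distrib)
    have Y0: "Y None None - Y None (Some i) = real_of_int (N - t ?i ?i) / real_of_int N"
      unfolding Y using diag[of ?i] sym[of 0 ?i] by (simp add: idx_None t00)
    fix j k
    show "0 \<le> vtail (\<lambda>j. Y j None - Y j (Some i)) $ j"
      using N le_diag[of "idx (Some j)" ?i] diag[of "idx (Some j)"] by (simp add: vtail_def Y)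
    show "vtail (\<lambda>j. Y j None - Y j (Some i)) $ j \<le> vhead (\<lambda>j. Y j None - Y j (Some i))"
      unfolding vtail_def vhead_def Y0 unfolding Y
      using supermod[of "idx (Some j)" ?i] diag[of "idx (Some j)"] by (simp add: div del: of_int_diff)
    assume "E j k"
    then show "vtail (\<lambda>j. Y j None - Y j (Some i)) $ j + vtail (\<lambda>j. Y j None - Y j (Some i)) $ k
        \<le> vhead (\<lambda>j. Y j None - Y j (Some i))"
      unfolding vtail_def vhead_def Y0 vec_lambda_beta unfolding Y
      using co_edge[OF _ i, of j k] by (intro frac_le) simp
  qed
  ultimately have "Y \<in> M_plus (ESTAB E)"
    by (simp add: M_plus_def)
  moreover have "Y None None = 1"
    using N by (simp add: Y_def idx_None t00)
  moreover have "0 \<le> x $ i \<and> x $ i \<le> 1" for i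
  proof -
    have "t (idx (Some i)) 0 \<le> N"
      using le_diag[of 0 "idx (Some i)"] sym[of 0 "idx (Some i)"] t00 by simp
    then show ?thesis
      using N nonneg[of "idx (Some i)" 0] by (simp add: x_def Y_def idx_None)
  qed
  ultimately have "x \<in> LS_plus (ESTAB E)"
    unfolding LS_plus_def x_def by fastforce
  moreover have "x \<notin> STAB E"
  proof
    assume "x \<in> STAB E"
    moreover have "card (S \<inter> set ps) \<le> b" if S: "stable_set E S" for S
    proof (rule ccontr)
      assume large: "\<not> card (S \<inter> set ps) \<le> b"
      define xs where "xs = filter (\<lambda>k. ps ! k \<in> S) [0..<m]"
      have "(!) ps ` set xs = S \<inter> set ps"
        using ps(2) by (auto simp: xs_def in_set_conv_nth image_iff)
      moreover have "card ((!) ps ` set xs) \<le> length xs"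
        by (metis card_image_le card_length finite_set order_trans)
      ultimately have "b < length xs"
        using large by simp
      moreover have "xs \<in> set (subseqs [0..<m])"
        by (simp add: xs_def filter_in_subseqs)
      ultimately obtain k l where "(k, l) \<in> set es" "k \<in> set xs" "l \<in> set xs"
        using rank by blast
      then show False
        using S adj[of k l] by (auto simp: xs_def stable_set_def)
    qed
    ultimately have "(\<Sum>i\<in>set ps. x $ i) \<le> real b"
      by (rule STAB_rank_le)
    moreover have "(\<Sum>i\<in>set ps. x $ i) = (\<Sum>k<m. x $ (ps ! k))"
      using ps by (auto intro!: sum.reindex_bij_betw[symmetric] bij_betw_nth)
    moreover have "\<dots> = real_of_int (\<Sum>k<m. T ! Suc k ! 0) / real_of_int N"
      unfolding of_int_sum sum_divide_distrib
      by (rule sum.cong) (auto simp: x_def Y_def idx_ps idx_None t_def)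
    moreover have "(\<Sum>k<m. T ! Suc k ! 0) > int b * N"
      using T_sum by (simp add: interv_sum_list_conv_sum_set_nat atLeast0LessThan)
    then have "real_of_int (\<Sum>k<m. T ! Suc k ! 0) > real b * real_of_int N"
      by (metis of_int_less_iff of_int_mult of_int_of_nat_eq)
    ultimately show False
      using N by (simp add: divide_le_eq)
  qed
  ultimately show ?thesis
    unfolding LS_plus_perfect_def by blast
qed

text \<open>The violations of the three certificates are narrow: 138 against 2 * 68, 157 against 2 *
  78, and 136 against 3 * 45. In each, the first square is the first row of the matrix with weight
  \<open>c\<close> divided by the corner entry; the other squares decompose the Schur
  complement.\<close>

lemma rank_violation_hole_plus_degree_3:
  "rank_violation 6 [(0,1),(1,2),(2,3),(3,4),(0,4),(5,0),(5,1),(5,2)] 2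
     [[68, 38, 8, 38, 23, 23, 8],
      [38, 38, 0, 19, 19, 0, 0],
      [8, 0, 8, 0, 4, 4, 0],
      [38, 19, 0, 38, 0, 19, 0],
      [23, 19, 4, 0, 23, 0, 4],
      [23, 0, 4, 19, 0, 23, 4],
      [8, 0, 0, 0, 4, 4, 8]]
     168625380
     [(2479785, [68, 38, 8, 38, 23, 23, 8]),
      (3141061, [0, 30, -8, -4, 11, -23, -8]),
      (2043944, [0, 0, 22, -19, 11, -8, -8]),
      (10402215, [0, 0, 0, 14, -11, 3, -8]),
      (53295, [0, 0, 0, 0, 113, 1, -40]),
      (209440, [0, 0, 0, 0, 0, 57, -20]),
      (23666720, [0, 0, 0, 0, 0, 0, 1])]"
  by code_simp

lemma rank_violation_hole_plus_degree_4:
  "rank_violation 6 [(0,1),(1,2),(2,3),(3,4),(0,4),(5,0),(5,1),(5,2),(5,3)] 2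
     [[78, 30, 30, 30, 30, 32, 5],
      [30, 30, 0, 15, 15, 0, 0],
      [30, 0, 30, 0, 15, 15, 0],
      [30, 15, 0, 30, 0, 15, 0],
      [30, 15, 15, 0, 30, 0, 0],
      [32, 0, 15, 15, 0, 32, 5],
      [5, 0, 0, 0, 0, 5, 5]]
     1872
     [(24, [78, 30, 30, 30, 30, 32, 5]),
      (15, [0, 48, -30, 9, 9, -32, -5]),
      (65, [0, 0, 18, -15, 9, -8, -5]),
      (130, [0, 0, 0, 12, -9, 1, -5]),
      (78, [0, 0, 0, 0, 15, -11, -5]),
      (1560, [0, 0, 0, 0, 0, 2, -1])]"
  by code_simp

text \<open>This is the line graph of the theta graph with paths of lengths 2, 3 and 3. That graph
  has seven vertices, hence matchings of at most three edges, and the rank inequality is the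
  corresponding odd-set inequality for matchings.\<close>

lemma rank_violation_linked_triangles:
  "rank_violation 8 [(0,1),(0,2),(0,3),(2,3),(1,4),(1,5),(4,5),(2,6),(6,4),(3,7),(7,5)] 3
     [[45, 17, 17, 12, 12, 12, 12, 27, 27],
      [17, 17, 0, 0, 0, 5, 5, 12, 12],
      [17, 0, 17, 5, 5, 0, 0, 12, 12],
      [12, 0, 5, 12, 0, 7, 2, 0, 10],
      [12, 0, 5, 0, 12, 2, 7, 10, 0],
      [12, 5, 0, 7, 2, 12, 0, 0, 10],
      [12, 5, 0, 2, 7, 0, 12, 10, 0],
      [27, 12, 12, 0, 10, 0, 10, 27, 15],
      [27, 12, 12, 10, 0, 10, 0, 15, 27]]
     3706950083760
     [(82376668528, [45, 17, 17, 12, 12, 12, 12, 27, 27]),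
      (173060228, [0, 476, -289, -204, -204, 21, 21, 81, 81]),
      (707973660, [0, 0, 187, -64, -64, -119, -119, 81, 81]),
      (17450055, [0, 0, 0, 1136, -1108, 476, -459, -1017, 853]),
      (155388585, [0, 0, 0, 0, 84, 8, 43, -211, -281]),
      (363165, [0, 0, 0, 0, 0, 7148, -7013, -4411, 3919]),
      (1186339, [0, 0, 0, 0, 0, 0, 765, -1169, -1619]),
      (625249856, [0, 0, 0, 0, 0, 0, 0, 31, -14]),
      (478316139840, [0, 0, 0, 0, 0, 0, 0, 0, 1])]"
  by code_simp

subsection \<open>Facets with full support\<close>

definition weight :: "real^'n::finite \<Rightarrow> 'n set \<Rightarrow> real" where
  "weight a S = (\<Sum>i\<in>S. a $ i)"

lemma inner_incidence_vector: "a \<bullet> incidence_vector S = weight a S"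
  by (simp add: inner_vec_def incidence_vector_def weight_def sum.If_cases if_distrib cong: if_cong)

lemma weight_Un_disjoint: "S \<inter> S' = {} \<Longrightarrow> weight a (S \<union> S') = weight a S + weight a S'"
  by (simp add: weight_def sum.union_disjoint)

lemma incidence_vector_in_STAB: "stable_set E S \<Longrightarrow> incidence_vector S \<in> STAB E"
  unfolding STAB_def by (blast intro: hull_inc)

text \<open>The origin and the unit vectors lie in \<open>STAB E\<close>, because the empty set and
  the singletons are stable. Full dimension makes the hyperplane through a facet unique.\<close>

lemma aff_dim_STAB:
  fixes E :: "'n::finite \<Rightarrow> 'n \<Rightarrow> bool"
  assumes "simple_graph E"
  shows "aff_dim (STAB E) = int (CARD('n))"
proof -
  have in_span: "x \<in> span (STAB E)" for x :: "real^'n"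
  proof -
    have "axis i 1 \<in> STAB E" for i :: 'n
    proof -
      have "stable_set E {i}"
        using assms by (simp add: stable_set_def simple_graph_def)
      moreover have "incidence_vector {i} = axis i (1::real)"
        by (simp add: incidence_vector_def axis_def)
      ultimately show ?thesis
        using incidence_vector_in_STAB by metis
    qed
    then have "(\<Sum>i\<in>UNIV. x $ i *\<^sub>R axis i 1) \<in> span (STAB E)"
      by (intro span_sum span_scale span_base)
    moreover have "(\<Sum>i\<in>UNIV. x $ i *\<^sub>R axis i 1) = x"
      using basis_expansion[of x] by (simp add: scalar_mult_eq_scaleR)
    ultimately show ?thesis
      by simp
  qed
  have "incidence_vector {} = (0 :: real^'n)"
    by (simp add: incidence_vector_def vec_eq_iff)
  then have "(0 :: real^'n) \<in> STAB E"
    using incidence_vector_in_STAB[of E "{}"] by (simp add: stable_set_def)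
  then have "aff_dim (STAB E) = int (dim (STAB E))"
    by (intro aff_dim_zero hull_inc)
  moreover have "dim (STAB E) = dim (UNIV :: (real^'n) set)"
    using in_span by (metis UNIV_eq_I dim_span)
  ultimately show ?thesis
    by simp
qed

text \<open>\<open>nontrivial\<close> excludes the one-vertex graph, whose nonnegativity constraint
  is a facet of full support with a negative coefficient.\<close>

locale facet_graph =
  fixes E :: "'n::finite \<Rightarrow> 'n \<Rightarrow> bool" and a :: "real^'n" and b :: real
  assumes simple: "simple_graph E"
    and a_nonzero: "\<And>i. a $ i \<noteq> 0"
    and valid: "\<And>x. x \<in> STAB E \<Longrightarrow> a \<bullet> x \<le> b"
    and facet: "(STAB E \<inter> {x. a \<bullet> x = b}) facet_of STAB E"
    and nontrivial: "CARD('n) \<ge> 2"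
begin

definition tight :: "'n set \<Rightarrow> bool" where
  "tight S \<longleftrightarrow> stable_set E S \<and> weight a S = b"

lemma adj_sym: "E i j \<Longrightarrow> E j i" and adj_irrefl: "\<not> E i i"
  using simple by (auto simp: simple_graph_def)

lemma weight_le: "stable_set E S \<Longrightarrow> weight a S \<le> b"
  using valid[OF incidence_vector_in_STAB] by (simp add: inner_incidence_vector)

text \<open>The tight sets span the facet affinely, and the facet spans the hyperplane
  \<open>a \<bullet> x = b\<close>. So a functional constant on the tight sets is a multiple of
  \<open>a\<close>, and a zero coordinate makes the multiple zero.\<close>

lemma coefficient_zero:
  assumes "\<And>S. tight S \<Longrightarrow> weight c S = \<beta>" and "c $ i = 0"
  shows "c = 0"
proof -
  let ?F = "STAB E \<inter> {x. a \<bullet> x = b}"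
  have "compact {incidence_vector S | S. stable_set E S}"
    by (rule finite_imp_compact, rule finite_image_set) simp
  moreover have "?F face_of convex hull {incidence_vector S | S. stable_set E S}"
    using facet_of_imp_face_of[OF facet] by (simp only: STAB_def)
  ultimately obtain H where H: "H \<subseteq> {incidence_vector S | S. stable_set E S}" "?F = convex hull H"
    by (rule face_of_convex_hull_subset)
  have "H \<subseteq> {x. c \<bullet> x = \<beta>}"
  proof
    fix x
    assume "x \<in> H"
    then obtain S where "stable_set E S" "x = incidence_vector S"
      using H(1) by blast
    moreover have "a \<bullet> x = b"
      using \<open>x \<in> H\<close> H(2) hull_inc[of x H convex] by auto
    ultimately show "x \<in> {x. c \<bullet> x = \<beta>}"
      using assms(1) by (simp add: inner_incidence_vector tight_def)
  qed
  then have "H \<subseteq> {x. c \<bullet> x = \<beta>}" .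
  then have "?F \<subseteq> {x. c \<bullet> x = \<beta>}"
    unfolding H(2) using convex_hyperplane by (intro hull_minimal)
  then have hull_c: "affine hull ?F \<subseteq> {x. c \<bullet> x = \<beta>}"
    using affine_hyperplane by (intro hull_minimal)
  have a: "a \<noteq> 0"
    using a_nonzero by (metis zero_index)
  have "aff_dim ?F = aff_dim {x. a \<bullet> x = b}"
    using facet aff_dim_STAB[OF simple] a by (simp add: facet_of_def aff_dim_hyperplane)
  then have "affine hull ?F = affine hull {x. a \<bullet> x = b}"
    by (metis aff_dim_psubset hull_mono inf_le2 less_irrefl psubsetI)
  then have hyp: "{x. a \<bullet> x = b} \<subseteq> {x. c \<bullet> x = \<beta>}"
    using hull_c hull_subset[of "{x. a \<bullet> x = b}" affine] by auto
  \<comment> \<open>\<open>d\<close> is the part of \<open>c\<close> orthogonal to \<open>a\<close>.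
    Moving along \<open>d\<close> stays in the hyperplane of the facet, so
    \<open>c \<bullet> d = 0\<close> and thus \<open>d = 0\<close>.\<close>
  define d where "d = c - (c \<bullet> a / (a \<bullet> a)) *\<^sub>R a"
  define x where "x = (b / (a \<bullet> a)) *\<^sub>R a"
  have ad: "a \<bullet> d = 0"
    using a by (simp add: d_def inner_diff_right inner_commute)
  have "a \<bullet> x = b"
    using a by (simp add: x_def)
  moreover have "a \<bullet> (x + d) = b"
    using \<open>a \<bullet> x = b\<close> ad by (simp add: inner_add_right)
  ultimately have "c \<bullet> x = \<beta>" "c \<bullet> (x + d) = \<beta>"
    using hyp by blast+
  then have "c \<bullet> d = 0"
    by (simp add: inner_add_right)
  then have "d \<bullet> d = 0"
    using ad by (simp add: d_def inner_diff_left)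
  then obtain l where c: "c = l *\<^sub>R a"
    by (metis d_def eq_iff_diff_eq_0 inner_eq_zero_iff)
  then have "l = 0"
    using assms(2) a_nonzero[of i] by simp
  then show ?thesis
    using c by simp
qed

lemma tight_proper_face:
  assumes "c $ i = 0" and "c \<noteq> 0"
  obtains S where "tight S" and "weight c S \<noteq> \<beta>"
  using coefficient_zero[of c \<beta> i] assms by blast

lemma weight_indicator:
  fixes K :: "'n set"
  shows "weight (\<chi> i. if i \<in> K then 1 else 0) S = real (card (S \<inter> K))"
  by (simp add: weight_def sum.If_cases Int_def)

text \<open>Some tight set contains \<open>i\<close>, as otherwise coordinate \<open>i\<close> would
  vanish on all of them; dropping \<open>i\<close> from it cannot raise the weight above
  \<open>b\<close>.\<close>

lemma a_pos: "0 < a $ i"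
proof -
  have "\<exists>j. j \<noteq> i"
  proof (rule ccontr)
    assume "\<nexists>j. j \<noteq> i"
    then have "(UNIV :: 'n set) = {i}"
      by blast
    then have "CARD('n) = card {i}"
      by (rule arg_cong)
    then show False
      using nontrivial by simp
  qed
  then obtain j where "j \<noteq> i" by blast
  define c :: "real^'n" where "c = (\<chi> k. if k \<in> {i} then 1 else 0)"
  have "c $ j = 0" "c \<noteq> 0"
    using \<open>j \<noteq> i\<close> by (auto simp: c_def vec_eq_iff)
  then obtain S where S: "tight S" "weight c S \<noteq> 0"
    by (rule tight_proper_face)
  then have "i \<in> S"
    unfolding c_def weight_indicator by auto
  then have "weight a S = a $ i + weight a (S - {i})"
    by (simp add: weight_def sum.remove)
  moreover have "weight a (S - {i}) \<le> b"
    using S(1) by (intro weight_le) (auto simp: tight_def stable_set_def)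
  ultimately show ?thesis
    using S(1) a_nonzero[of i] by (simp add: tight_def)
qed

lemma tight_maximal:
  assumes "tight S" "v \<notin> S"
  obtains u where "u \<in> S" "E u v"
proof -
  have "\<not> stable_set E (insert v S)"
  proof
    assume "stable_set E (insert v S)"
    then have "weight a (insert v S) \<le> b"
      by (rule weight_le)
    then show False
      using assms a_pos[of v] by (simp add: weight_def tight_def)
  qed
  then show ?thesis
    using assms(1) that adj_sym adj_irrefl unfolding stable_set_def tight_def by blast
qed

text \<open>The clique functional is zero at \<open>v\<close>, so it is not equal to 1 on all tight
  sets, and a stable set meets a clique at most once.\<close>

lemma tight_avoiding_clique:
  assumes "clique E K" "K \<noteq> {}" "v \<notin> K"
  obtains S where "tight S" "S \<inter> K = {}"
proof -
  define c :: "real^'n" where "c = (\<chi> k. if k \<in> K then 1 else 0)"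
  have "c $ v = 0" "c \<noteq> 0"
    using assms by (auto simp: c_def vec_eq_iff)
  then obtain S where S: "tight S" "weight c S \<noteq> 1"
    by (rule tight_proper_face)
  have "card (S \<inter> K) \<le> 1"
  proof (rule ccontr)
    assume "\<not> card (S \<inter> K) \<le> 1"
    then obtain i j where "i \<in> S \<inter> K" "j \<in> S \<inter> K" "i \<noteq> j"
      using card_le_Suc0_iff_eq[of "S \<inter> K"] by auto
    then show False
      using S(1) assms(1) by (auto simp: tight_def stable_set_def clique_def)
  qed
  with S(2) have "card (S \<inter> K) = 0"
    unfolding c_def weight_indicator by linarith
  then show ?thesis
    using that S(1) by simp
qed

text \<open>Tight sets with the same trace on \<open>K\<close> can exchange their parts in
  \<open>A\<close>, so the weight inside \<open>A\<close> depends only on the trace. The trace is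
  empty or one vertex, so this dependence is linear and gives a functional that is constant on tight
  sets and zero on \<open>B\<close>.\<close>

theorem no_clique_cutset:
  assumes "A \<union> K \<union> B = UNIV" "A \<inter> K = {}" "A \<inter> B = {}" "B \<inter> K = {}"
    and "A \<noteq> {}" "B \<noteq> {}" "clique E K"
    and sep: "\<And>i j. i \<in> A \<Longrightarrow> j \<in> B \<Longrightarrow> \<not> E i j"
  shows False
proof -
  have swap: "weight a (S \<inter> A) \<le> weight a (S' \<inter> A)"
    if "tight S" "tight S'" "S \<inter> K = S' \<inter> K" for S S'
  proof -
    let ?W = "S \<inter> A \<union> S' \<inter> (K \<union> B)"
    have "stable_set E ?W"
      unfolding stable_set_def
    proof (intro ballI)
      fix i j
      assume ij: "i \<in> ?W" "j \<in> ?W"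
      have "i \<in> S \<and> j \<in> S \<or> i \<in> S' \<and> j \<in> S' \<or> i \<in> A \<and> j \<in> B \<or> i \<in> B \<and> j \<in> A"
        using ij that(3) by blast
      then show "\<not> E i j"
        using that(1,2) sep adj_sym unfolding tight_def stable_set_def by blast
    qed
    then have "weight a ?W \<le> b"
      by (rule weight_le)
    moreover have "weight a ?W = weight a (S \<inter> A) + weight a (S' \<inter> (K \<union> B))"
      using assms(2,3) by (intro weight_Un_disjoint) auto
    moreover have "weight a (S' \<inter> A \<union> S' \<inter> (K \<union> B)) = weight a (S' \<inter> A) + weight a (S' \<inter> (K \<union> B))"
      using assms(2,3) by (intro weight_Un_disjoint) auto
    moreover have "S' \<inter> A \<union> S' \<inter> (K \<union> B) = S'"
      using assms(1) by blast
    ultimately show ?thesis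
      using that(2) by (simp add: tight_def)
  qed
  define g where "g X = weight a ((SOME S. tight S \<and> S \<inter> K = X) \<inter> A)" for X
  have g: "weight a (S \<inter> A) = g (S \<inter> K)" if "tight S" for S
  proof -
    let ?S = "SOME S'. tight S' \<and> S' \<inter> K = S \<inter> K"
    have "tight ?S \<and> ?S \<inter> K = S \<inter> K"
      by (rule someI[of _ S]) (simp add: that)
    then have "weight a (S \<inter> A) = weight a (?S \<inter> A)"
      using that by (intro order_antisym swap) auto
    then show ?thesis
      by (simp only: g_def)
  qed
  \<comment> \<open>On \<open>K\<close> the coefficient corrects \<open>g {i}\<close> to the common
    value \<open>g {}\<close>. If no tight set avoids \<open>K\<close>, then \<open>g {}\<close> is
    unspecified, but it is still a constant.\<close>
  define c :: "real^'n" where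
    "c = (\<chi> i. if i \<in> A then a $ i else if i \<in> K then g {} - g {i} else 0)"
  have "weight c S = g {}" if "tight S" for S
  proof -
    have "weight c S = weight c (S \<inter> A) + weight c (S \<inter> K) + weight c (S \<inter> B)"
    proof -
      have "S = (S \<inter> A \<union> S \<inter> K) \<union> S \<inter> B"
        using assms(1) by blast
      moreover have "weight c ((S \<inter> A \<union> S \<inter> K) \<union> S \<inter> B)
          = weight c (S \<inter> A) + weight c (S \<inter> K) + weight c (S \<inter> B)"
        using assms(2-4) weight_Un_disjoint[of "S \<inter> A" "S \<inter> K" c]
          weight_Un_disjoint[of "S \<inter> A \<union> S \<inter> K" "S \<inter> B" c] by fastforce
      ultimately show ?thesis
        by simp
    qed
    moreover have "weight c (S \<inter> A) = g (S \<inter> K)"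
      using g[OF that] by (simp add: weight_def c_def)
    moreover have "weight c (S \<inter> B) = 0"
      unfolding weight_def using assms(3,4) by (intro sum.neutral) (auto simp: c_def)
    moreover have "weight c (S \<inter> K) = g {} - g (S \<inter> K)"
    proof (cases "S \<inter> K = {}")
      case True
      then show ?thesis by (simp add: weight_def)
    next
      case False
      then obtain k where "k \<in> S \<inter> K" by blast
      then have "S \<inter> K = {k}"
        using that \<open>clique E K\<close> unfolding tight_def stable_set_def clique_def by blast
      moreover have "k \<in> K" "k \<notin> A"
        using \<open>k \<in> S \<inter> K\<close> assms(2) by auto
      ultimately show ?thesis
        by (simp add: weight_def c_def)
    qed
    ultimately show ?thesis
      by simp
  qed
  moreover obtain j where "j \<in> B"
    using assms(6) by blast
  then have "c $ j = 0"
    using assms(3,4) by (auto simp: c_def)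
  ultimately have "c = 0"
    by (rule coefficient_zero)
  moreover obtain i where "i \<in> A"
    using assms(5) by blast
  ultimately show False
    using a_nonzero[of i] by (auto simp: c_def dest: vec_eq_iff[THEN iffD1, THEN spec[of _ i]])
qed

text \<open>The empty set is a clique, so the graph is connected.\<close>

corollary no_separation:
  assumes "u \<in> A" "v \<notin> A" "\<And>i j. i \<in> A \<Longrightarrow> j \<notin> A \<Longrightarrow> \<not> E i j"
  shows False
  by (rule no_clique_cutset[of A "{}" "- A"]) (use assms in \<open>auto simp: clique_def\<close>)

end

subsection \<open>Forbidden induced subgraphs\<close>

locale perfect_facet_graph = facet_graph E a b
  for E :: "'n::finite \<Rightarrow> 'n \<Rightarrow> bool" and a b +
  assumes claw_free: "claw_free E"
    and perfect: "LS_plus_perfect E"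
    and alpha: "stability_number E = 3"
begin

lemma no_claw:
  assumes "E c x" "E c y" "E c w" "x \<noteq> y" "x \<noteq> w" "y \<noteq> w"
    "\<not> E x y" "\<not> E x w" "\<not> E y w"
  shows False
  using claw_free assms unfolding claw_free_def by blast

definition hole5 :: "'n \<Rightarrow> 'n \<Rightarrow> 'n \<Rightarrow> 'n \<Rightarrow> 'n \<Rightarrow> bool" where
  "hole5 c1 c2 c3 c4 c5 \<longleftrightarrow> E c1 c2 \<and> E c2 c3 \<and> E c3 c4 \<and> E c4 c5 \<and> E c5 c1 \<and>
     \<not> E c1 c3 \<and> \<not> E c1 c4 \<and> \<not> E c2 c4 \<and> \<not> E c2 c5 \<and> \<not> E c3 c5"

lemma no_hole_plus_degree_3:
  assumes "hole5 c1 c2 c3 c4 c5" "E v c1" "E v c2" "E v c3" "\<not> E v c4" "\<not> E v c5"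
  shows False
proof -
  let ?ps = "[c1, c2, c3, c4, c5, v]"
  have "distinct ?ps"
    using assms adj_irrefl by (auto simp: hole5_def dest: adj_sym)
  moreover have "\<forall>k<6. \<forall>l<6. E (?ps ! k) (?ps ! l) \<longleftrightarrow>
      (k, l) \<in> set [(0,1),(1,2),(2,3),(3,4),(0,4),(5,0),(5,1),(5,2)] \<or>
      (l, k) \<in> set [(0,1),(1,2),(2,3),(3,4),(0,4),(5,0),(5,1),(5,2)]"
    using assms adj_irrefl
    by (simp add: hole5_def All_less_Suc eval_nat_numeral) (blast dest: adj_sym)
  ultimately show False
    using not_LS_plus_perfect_if_rank_violation[OF rank_violation_hole_plus_degree_3, of ?ps E] perfect by simp
qed

lemma no_hole_plus_degree_4:
  assumes "hole5 c1 c2 c3 c4 c5" "E v c1" "E v c2" "E v c3" "E v c4" "\<not> E v c5"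
  shows False
proof -
  let ?ps = "[c1, c2, c3, c4, c5, v]"
  have "distinct ?ps"
    using assms adj_irrefl by (auto simp: hole5_def dest: adj_sym)
  moreover have "\<forall>k<6. \<forall>l<6. E (?ps ! k) (?ps ! l) \<longleftrightarrow>
      (k, l) \<in> set [(0,1),(1,2),(2,3),(3,4),(0,4),(5,0),(5,1),(5,2),(5,3)] \<or>
      (l, k) \<in> set [(0,1),(1,2),(2,3),(3,4),(0,4),(5,0),(5,1),(5,2),(5,3)]"
    using assms adj_irrefl
    by (simp add: hole5_def All_less_Suc eval_nat_numeral) (blast dest: adj_sym)
  ultimately show False
    using not_LS_plus_perfect_if_rank_violation[OF rank_violation_hole_plus_degree_4, of ?ps E] perfect by simp
qed

lemma no_linked_triangles:
  assumes "E p q"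
    and "E p x" "E p y" "E x y" "E q x'" "E q y'" "E x' y'"
    and "E x u" "E u x'" "E y v" "E v y'"
    and "\<not> E p x'" "\<not> E p y'" "\<not> E p u" "\<not> E p v"
    and "\<not> E q x" "\<not> E q y" "\<not> E q u" "\<not> E q v"
    and "\<not> E x x'" "\<not> E x y'" "\<not> E x v" "\<not> E y x'" "\<not> E y y'" "\<not> E y u"
    and "\<not> E x' v" "\<not> E y' u" "\<not> E u v"
  shows False
proof -
  let ?ps = "[p, q, x, y, x', y', u, v]"
  have "distinct ?ps"
    using assms adj_irrefl by (auto dest: adj_sym)
  moreover have "\<forall>k<8. \<forall>l<8. E (?ps ! k) (?ps ! l) \<longleftrightarrow>
      (k, l) \<in> set [(0,1),(0,2),(0,3),(2,3),(1,4),(1,5),(4,5),(2,6),(6,4),(3,7),(7,5)] \<or>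
      (l, k) \<in> set [(0,1),(0,2),(0,3),(2,3),(1,4),(1,5),(4,5),(2,6),(6,4),(3,7),(7,5)]"
    using assms adj_irrefl
    by (simp add: All_less_Suc eval_nat_numeral) (blast dest: adj_sym)
  ultimately show False
    using not_LS_plus_perfect_if_rank_violation[OF rank_violation_linked_triangles, of ?ps E] perfect by simp
qed

lemma stable_card_le: "stable_set E S \<Longrightarrow> card S \<le> 3"
  and stable_triple_exists: "\<exists>S. stable_set E S \<and> card S = 3"
proof -
  let ?C = "{card S | S. stable_set E S}"
  have fin: "finite ?C"
    by (rule finite_image_set) simp
  have "stable_set E {}"
    by (simp add: stable_set_def)
  then have "?C \<noteq> {}"
    by blast
  then have "Max ?C \<in> ?C"
    using fin by (rule Max_in[rotated])
  then show "\<exists>S. stable_set E S \<and> card S = 3"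
    using alpha unfolding stability_number_def by auto
  show "card S \<le> 3" if "stable_set E S"
    using Max_ge[OF fin, of "card S"] that alpha unfolding stability_number_def by auto
qed

lemma stable_triple:
  obtains x y w where "x \<noteq> y" "x \<noteq> w" "y \<noteq> w" "\<not> E x y" "\<not> E x w" "\<not> E y w"
proof -
  obtain S where "stable_set E S" "card S = 3"
    using stable_triple_exists by blast
  then show ?thesis
    using that unfolding card_3_iff stable_set_def by blast
qed

lemma no_stable_quadruple:
  assumes "distinct [x, y, w, u]" "\<not> E x y" "\<not> E x w" "\<not> E x u" "\<not> E y w" "\<not> E y u" "\<not> E w u"
  shows False
proof -
  have "stable_set E {x, y, w, u}"
    using assms adj_sym adj_irrefl unfolding stable_set_def by blast
  then show False
    using stable_card_le assms(1) by fastforce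
qed

subsection \<open>Long odd antiholes\<close>

text \<open>The antihole is unrolled to a sequence of period \<open>n\<close> whose consecutive
  terms are nonadjacent; adding multiples of \<open>n\<close> replaces subtraction of
  indices.\<close>

context
  fixes f :: "nat \<Rightarrow> 'n" and n :: nat
  assumes n: "odd n" "7 \<le> n"
    and per: "\<And>i. f (i + n) = f i"
    and adj: "\<And>i d. 0 < d \<Longrightarrow> d < n \<Longrightarrow> E (f i) (f (i + d)) \<longleftrightarrow> d \<noteq> 1 \<and> d \<noteq> n - 1"
begin

lemma per_mult: "f (i + k * n) = f i"
proof (induction k)
  case (Suc k)
  have "i + Suc k * n = i + k * n + n"
    by simp
  then show ?case
    using Suc per by metis
qed simp

lemma range_shift: "\<exists>d<n. f i = f (j + d)"
proof -
  \<comment> \<open>This is \<open>i - j\<close> modulo \<open>n\<close>: the factor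
    \<open>n - 1\<close> acts as -1.\<close>
  let ?d = "(i + j * (n - 1)) mod n"
  have f_mod: "f k = f (k mod n)" for k
    using per_mult[of "k mod n" "k div n"] by simp
  have "(j + ?d) mod n = (i + (j + j * (n - 1))) mod n"
    by (simp add: mod_add_right_eq ac_simps)
  also have "j + j * (n - 1) = j * n"
    using n(2) by (cases n) auto
  finally have "f i = f (j + ?d)"
    using f_mod[of i] f_mod[of "j + ?d"] by simp
  moreover have "?d < n"
    using n(2) by simp
  ultimately show ?thesis
    by blast
qed

lemma consecutive: "\<not> E (f i) (f (i + 1))" "f i \<noteq> f (i + 1)"
proof -
  show "\<not> E (f i) (f (i + 1))"
    using adj[of 1 i] n(2) by simp
  show "f i \<noteq> f (i + 1)"
    using adj[of 2 i] adj[of 1 "i + 1"] n(2) by auto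
qed

text \<open>Antihole vertices not next to the pair \<open>f j\<close>, \<open>f (j + 1)\<close> see
  both, so a neighbour of \<open>w\<close> among them would centre a claw. Only the two vertices
  next to the pair remain; restarting at \<open>j + 3\<close> and \<open>j + 4\<close> reaches
  them.\<close>

lemma anticomplete_if_consecutive_nonneighbors:
  assumes w: "w \<notin> range f" "\<not> E w (f j)" "\<not> E w (f (j + 1))"
  shows "\<not> E w (f i)"
proof -
  have step: "\<not> E w (f (k + d))"
    if "\<not> E w (f k)" "\<not> E w (f (k + 1))" "3 \<le> d" "d \<le> n - 2" for k d
  proof
    assume "E w (f (k + d))"
    moreover have "E (f (k + d)) (f k)"
      using adj[of d k] that(3,4) n(2) adj_sym by simp
    moreover have "E (f (k + d)) (f (k + 1))"
    proof -
      have "d - 1 < n" "0 < d - 1" "d - 1 \<noteq> 1" "d - 1 \<noteq> n - 1" "k + 1 + (d - 1) = k + d"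
        using that(3,4) n(2) by linarith+
      then show ?thesis
        using adj[of "d - 1" "k + 1"] adj_sym by metis
    qed
    moreover have "w \<noteq> f k" "w \<noteq> f (k + 1)"
      using w(1) by auto
    ultimately show False
      using no_claw[of "f (k + d)" w "f k" "f (k + 1)"] adj_sym that(1,2) consecutive[of k] by blast
  qed
  have "\<not> E w (f (j + 3))" "\<not> E w (f (j + 4))" "\<not> E w (f (j + 5))"
  proof -
    have "3 \<le> n - 2" "4 \<le> n - 2" "5 \<le> n - 2"
      using n(2) by linarith+
    then show "\<not> E w (f (j + 3))" "\<not> E w (f (j + 4))" "\<not> E w (f (j + 5))"
      using step[OF w(2,3)] by simp_all
  qed
  obtain d where d: "d < n" "f i = f (j + 3 + d)"
    using range_shift by blast
  consider "3 + d \<le> n - 2" | "3 \<le> d" "d \<le> n - 2" | "d = n - 1"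
    using d(1) n(2) by linarith
  then show ?thesis
  proof cases
    case 1
    then show ?thesis
      using step[of j "3 + d"] w d by (simp add: add.assoc)
  next
    case 2
    then show ?thesis
      using step[of "j + 3" d] \<open>\<not> E w (f (j + 3))\<close> \<open>\<not> E w (f (j + 4))\<close> d
      by (simp add: numeral_eq_Suc)
  next
    case 3
    have "3 \<le> n - 2"
      using n(2) by linarith
    moreover have "\<not> E w (f (j + 4 + 1))"
      using \<open>\<not> E w (f (j + 5))\<close> by (simp add: numeral_eq_Suc)
    moreover have "j + 4 + (n - 2) = j + 3 + d"
      using 3 n(2) by linarith
    ultimately show ?thesis
      using step[of "j + 4" "n - 2"] \<open>\<not> E w (f (j + 4))\<close> d(2) by (metis order_refl)
  qed
qed

text \<open>Neighbours and nonneighbours cannot alternate along a cycle of odd length.\<close>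
lemma consecutive_neighbors:
  assumes "w \<notin> range f" "E w (f i)"
  obtains j where "E w (f j)" "E w (f (j + 1))"
proof (rule ccontr)
  assume "\<not> thesis"
  then have "\<not> (E w (f j) \<and> E w (f (j + 1)))" for j
    using that by blast
  moreover have "E w (f j) \<or> E w (f (j + 1))" for j
    using anticomplete_if_consecutive_nonneighbors assms by blast
  ultimately have alternate: "E w (f (j + 1)) \<longleftrightarrow> \<not> E w (f j)" for j
    by blast
  have "E w (f (i + k)) \<longleftrightarrow> even k" for k
    using assms(2) alternate[of "i + _"] by (induction k) auto
  from this[of n] show False
    using n(1) per assms(2) by simp
qed

text \<open>The vertices missing the whole antihole form a union of components: a neighbour of one
  of them that sees the antihole sees two consecutive vertices of it and centres a claw.\<close>

lemma has_neighbor: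
  assumes "w \<notin> range f"
  shows "\<exists>i. E w (f i)"
proof (rule ccontr)
  assume "\<nexists>i. E w (f i)"
  let ?D = "{w. w \<notin> range f \<and> (\<forall>i. \<not> E w (f i))}"
  have "\<not> E u v" if uv: "u \<in> ?D" "v \<notin> ?D" for u v
  proof
    assume "E u v"
    then have "v \<notin> range f"
      using uv(1) by auto
    then obtain j where "E v (f j)" "E v (f (j + 1))"
      using uv(2) consecutive_neighbors by blast
    moreover have "u \<noteq> f j" "u \<noteq> f (j + 1)" "\<not> E u (f j)" "\<not> E u (f (j + 1))"
      using uv(1) by auto
    ultimately show False
      using no_claw[of v u "f j" "f (j + 1)"] \<open>E u v\<close> adj_sym consecutive by blast
  qed
  moreover have "w \<in> ?D"
    using assms \<open>\<nexists>i. E w (f i)\<close> by blast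
  moreover have "f 0 \<notin> ?D"
    by simp
  ultimately show False
    by (rule no_separation[rotated 2])
qed

lemma no_consecutive_nonneighbors:
  assumes "w \<notin> range f"
  shows "E w (f j) \<or> E w (f (j + 1))"
  using has_neighbor[OF assms] anticomplete_if_consecutive_nonneighbors[OF assms] by blast

text \<open>\<open>y\<close> lies on the 5-hole \<open>f i\<close>, \<open>f (i + 2)\<close>,
  \<open>y\<close>, \<open>f (i + 1)\<close>, \<open>f (i + 3)\<close>, of which
  \<open>f (i + 4)\<close> misses only the last vertex.\<close>

lemma no_gap_3:
  assumes y: "y \<notin> range f" "\<not> E y (f i)" "\<not> E y (f (i + 3))"
  shows False
proof -
  have "E y (f (i + 1))" "E y (f (i + 2))" "E y (f (i + 4))"
    using no_consecutive_nonneighbors[OF y(1), of i] no_consecutive_nonneighbors[OF y(1), of "i + 2"]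
      no_consecutive_nonneighbors[OF y(1), of "i + 3"] y(2,3) by (auto simp: numeral_eq_Suc)
  moreover have "hole5 (f i) (f (i + 2)) y (f (i + 1)) (f (i + 3))"
    unfolding hole5_def
    using calculation y adj[of 2 i] adj[of 1 i] adj[of 1 "i + 1"] adj[of 2 "i + 1"]
      adj[of 1 "i + 2"] adj[of 3 i] n(2) adj_sym by (auto simp: numeral_eq_Suc)
  ultimately show False
    using no_hole_plus_degree_4[of "f i" "f (i + 2)" y "f (i + 1)" "f (i + 3)" "f (i + 4)"]
      adj[of 4 i] adj[of 2 "i + 2"] adj[of 3 "i + 1"] adj[of 1 "i + 3"] n(2) adj_sym
    by (auto simp: numeral_eq_Suc)
qed

text \<open>Antihole vertices that see \<open>f i\<close> cannot see both \<open>x\<close> and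
  \<open>y\<close>. If one of the two missed \<open>f (i + 2)\<close>, it would see
  \<open>f (i + 3)\<close>, so the other would have a gap of three. Hence both see
  \<open>f (i + 2)\<close>, which is a claw.\<close>

lemma no_stable_triple_meeting_once:
  assumes x: "x \<notin> range f" "\<not> E x (f i)" and y: "y \<notin> range f" "\<not> E y (f i)"
    and xy: "x \<noteq> y" "\<not> E x y"
  shows False
proof -
  have far: "\<not> E u (f (i + d)) \<or> \<not> E v (f (i + d))"
    if uv: "u \<notin> range f" "\<not> E u (f i)" "v \<notin> range f" "\<not> E v (f i)" "u \<noteq> v" "\<not> E u v"
      and "2 \<le> d" "d \<le> n - 2" for u v d
  proof -
    have "E (f (i + d)) (f i)"
      using adj[of d i] that(7,8) n(2) adj_sym by simp
    moreover have "u \<noteq> f i" "v \<noteq> f i"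
      using uv by auto
    ultimately show ?thesis
      using no_claw[of "f (i + d)" u v "f i"] uv adj_sym by blast
  qed
  have *: "E u (f (i + 2))"
    if uv: "u \<notin> range f" "\<not> E u (f i)" "v \<notin> range f" "\<not> E v (f i)" "u \<noteq> v" "\<not> E u v" for u v
  proof (rule ccontr)
    assume "\<not> E u (f (i + 2))"
    then have "E u (f (i + 3))"
      using no_consecutive_nonneighbors[OF uv(1), of "i + 2"] by (simp add: numeral_eq_Suc)
    then have "\<not> E v (f (i + 3))"
      using far[OF uv, of 3] n(2) by simp
    then show False
      using no_gap_3 uv by blast
  qed
  have "E x (f (i + 2))" "E y (f (i + 2))"
    using *[of x y] *[of y x] x y xy adj_sym by blast+
  moreover have "2 \<le> n - 2"
    using n(2) by linarith
  ultimately show False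
    using far[OF x y xy, of 2] by simp
qed

lemma no_stable_triple_meeting_twice:
  assumes "u \<in> range f" "v \<in> range f" "u \<noteq> v" "\<not> E u v"
    and w: "w \<noteq> u" "w \<noteq> v" "\<not> E w u" "\<not> E w v"
  shows False
proof -
  obtain i d where i: "u = f i" "v = f (i + d)" "d < n"
    using assms(1,2) range_shift by (metis imageE)
  then have "d \<noteq> 0"
    using assms(3) by (metis add.right_neutral)
  then have "d = 1 \<or> d = n - 1"
    using adj[of d i] i assms(4) by auto
  then obtain j where j: "u = f j \<and> v = f (j + 1) \<or> v = f j \<and> u = f (j + 1)"
  proof
    assume "d = 1"
    then show ?thesis
      using i that by blast
  next
    assume "d = n - 1"
    then have "i + d + 1 = i + n"
      using n(2) by simp
    then have "f (i + d + 1) = u"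
      using i per by metis
    then show ?thesis
      using i(2) that by metis
  qed
  then have wj: "w \<noteq> f j" "w \<noteq> f (j + 1)" "\<not> E w (f j)" "\<not> E w (f (j + 1))"
    using w by auto
  show False
  proof (cases "w \<in> range f")
    case False
    then show ?thesis
      using no_consecutive_nonneighbors wj by blast
  next
    case True
    then obtain d where d: "d < n" "w = f (j + d)"
      using range_shift by (metis imageE)
    then have "d \<noteq> 0" "d \<noteq> 1"
      using wj(1,2) by (metis add.right_neutral, metis)
    then have "d = n - 1"
      using adj[of d j] d wj(3) adj_sym by auto
    then have "j + d = j + 1 + (n - 2)"
      using n(2) by linarith
    then have "w = f (j + 1 + (n - 2))"
      using d(2) by simp
    then have "E (f (j + 1)) w"
    proof -
      have "0 < n - 2" "n - 2 < n" "n - 2 \<noteq> 1" "n - 2 \<noteq> n - 1"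
        using n(2) by linarith+
      then show ?thesis
        using adj[of "n - 2" "j + 1"] \<open>w = f (j + 1 + (n - 2))\<close> by metis
    qed
    then show ?thesis
      using wj(4) adj_sym by blast
  qed
qed

text \<open>A stable triple outside the antihole 3-colours the antihole: each of its vertices misses
  exactly one of the three.\<close>
lemma no_stable_triple_outside:
  assumes x: "x \<notin> range f" and y: "y \<notin> range f" and w: "w \<notin> range f"
    and stable: "x \<noteq> y" "x \<noteq> w" "y \<noteq> w" "\<not> E x y" "\<not> E x w" "\<not> E y w"
  shows False
proof -
  have ex: "\<not> E x (f i) \<or> \<not> E y (f i) \<or> \<not> E w (f i)" for i
    using no_claw[of "f i" x y w] stable adj_sym by blast
  have uniq: "E x (f i) \<or> E y (f i)" "E x (f i) \<or> E w (f i)" "E y (f i) \<or> E w (f i)" for i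
    using no_stable_triple_meeting_once x y w stable by blast+
  \<comment> \<open>Three consecutive positions of different colours give the hole
    \<open>f (i + 3)\<close>, \<open>p\<close>, \<open>f (i + 2)\<close>, \<open>r\<close>,
    \<open>f (i + 1)\<close>, of which \<open>f i\<close> misses only the last vertex.\<close>
  have colours: False
    if p: "p \<in> {x, y, w}" "\<not> E p (f (i + 1))" and q: "q \<in> {x, y, w}" "\<not> E q (f (i + 2))"
      and r: "r \<in> {x, y, w}" "\<not> E r (f (i + 3))" and pqr: "p \<noteq> q" "q \<noteq> r" "p \<noteq> r" for p q r i
  proof -
    have out: "p \<notin> range f" "q \<notin> range f" "r \<notin> range f"
      using p q r x y w by auto
    have nonadj: "\<not> E p r"
      using p q r pqr stable adj_sym by blast
    have one: "E u (f j) \<or> E v (f j)" if "u \<in> {x, y, w}" "v \<in> {x, y, w}" "u \<noteq> v" for u v j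
      using that uniq by blast
    have "E p (f i)"
      using no_consecutive_nonneighbors[OF out(1), of i] p by blast
    moreover have "E r (f i)"
      using no_gap_3[OF out(3), of i] r by blast
    moreover have "E p (f (i + 2))" "E p (f (i + 3))" "E r (f (i + 1))" "E r (f (i + 2))"
      using one p q r pqr by blast+
    moreover have "hole5 (f (i + 3)) p (f (i + 2)) r (f (i + 1))"
      unfolding hole5_def
      using calculation nonadj p r adj[of 2 "i + 1"] adj[of 1 "i + 2"] adj[of 1 "i + 1"] n(2) adj_sym
      by (auto simp: numeral_eq_Suc)
    ultimately show False
      using no_hole_plus_degree_4[of "f (i + 3)" p "f (i + 2)" r "f (i + 1)" "f i"]
        adj[of 3 i] adj[of 2 i] adj[of 1 i] n(2) adj_sym by auto
  qed
  \<comment> \<open>Otherwise the colour of \<open>f 0\<close> recurs at all even positions, among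
    them \<open>n + 1\<close>, which is \<open>f 1\<close> again.\<close>
  have "\<exists>u\<in>{x, y, w}. \<exists>i. \<not> E u (f i) \<and> E u (f (i + 2))"
  proof (rule ccontr)
    assume *: "\<not> ?thesis"
    obtain u where u: "u \<in> {x, y, w}" "\<not> E u (f 0)"
      using ex[of 0] by blast
    have "\<not> E u (f (2 * k))" for k
    proof (induction k)
      case 0
      then show ?case using u(2) by simp
    next
      case (Suc k)
      then show ?case
        using * u(1) by fastforce
    qed
    moreover obtain k where "0 + 1 + n = 2 * k"
      using n(1) by (metis add.left_neutral evenE odd_even_add odd_one)
    ultimately have "\<not> E u (f (0 + 1))"
      using per[of "0 + 1"] by metis
    then show False
      using no_consecutive_nonneighbors[of u 0] u x y w by blast
  qed
  then obtain p i0 where p: "p \<in> {x, y, w}" "\<not> E p (f i0)" "E p (f (i0 + 2))"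
    by blast
  \<comment> \<open>\<open>i\<close> stands for \<open>i0 - 1\<close>; adding \<open>n\<close>
    avoids truncated subtraction.\<close>
  define i where "i = i0 + n - 1"
  have i: "i + 1 = i0 + n" "i + 2 = (i0 + 1) + n" "i + 3 = (i0 + 2) + n"
    using n(2) by (auto simp: i_def)
  have p_i: "\<not> E p (f (i + 1))" "E p (f (i + 3))"
    unfolding i per using p by auto
  obtain q where q: "q \<in> {x, y, w}" "\<not> E q (f (i + 2))"
    using ex[of "i + 2"] by blast
  obtain r where r: "r \<in> {x, y, w}" "\<not> E r (f (i + 3))"
    using ex[of "i + 3"] by blast
  have "p \<noteq> q"
    using no_consecutive_nonneighbors[of p "i + 1"] p_i p(1) q x y w by (auto simp: numeral_eq_Suc)
  moreover have "q \<noteq> r"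
    using no_consecutive_nonneighbors[of q "i + 2"] q r x y w by (auto simp: numeral_eq_Suc)
  moreover have "p \<noteq> r"
    using p_i r by blast
  ultimately show False
    using colours p(1) p_i q r by blast
qed

lemma no_long_odd_antihole: False
proof -
  obtain x y w where *: "x \<noteq> y" "x \<noteq> w" "y \<noteq> w" "\<not> E x y" "\<not> E x w" "\<not> E y w"
    by (rule stable_triple)
  have twice: "\<not> (u \<in> range f \<and> v \<in> range f)"
    if "u \<noteq> v" "\<not> E u v" "t \<noteq> u" "t \<noteq> v" "\<not> E t u" "\<not> E t v" for u v t
    using no_stable_triple_meeting_twice that by blast
  have once: "u \<notin> range f"
    if "u \<noteq> v" "u \<noteq> t" "v \<noteq> t" "\<not> E v u" "\<not> E t u" "\<not> E v t" "v \<notin> range f" "t \<notin> range f" for u v t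
    using no_stable_triple_meeting_once that by blast
  have sym: "\<not> E y x" "\<not> E w x" "\<not> E w y"
    using * adj_sym by blast+
  have "\<not> (x \<in> range f \<and> y \<in> range f)" "\<not> (x \<in> range f \<and> w \<in> range f)"
    "\<not> (y \<in> range f \<and> w \<in> range f)"
    using twice * sym by blast+
  moreover have "y \<notin> range f \<Longrightarrow> w \<notin> range f \<Longrightarrow> x \<notin> range f"
    "x \<notin> range f \<Longrightarrow> w \<notin> range f \<Longrightarrow> y \<notin> range f"
    "x \<notin> range f \<Longrightarrow> y \<notin> range f \<Longrightarrow> w \<notin> range f"
    using once[of x y w] once[of y x w] once[of w x y] * sym by auto
  ultimately show False
    using no_stable_triple_outside * by blast
qed

end

end

subsection \<open>Shortest odd closed walks\<close>

lemma relpow_sym: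
  assumes "sym R"
  shows "(x, y) \<in> R ^^ n \<Longrightarrow> (y, x) \<in> R ^^ n"
proof (induction n arbitrary: y)
  case (Suc n)
  then obtain z where "(x, z) \<in> R ^^ n" "(z, y) \<in> R"
    by auto
  then have "(z, x) \<in> R ^^ n" "(y, z) \<in> R"
    using Suc.IH assms by (auto dest: symD)
  then show ?case
    by (rule relpow_Suc_I2[rotated])
qed simp

text \<open>The colour is the parity of a walk from the root of the component; walks of both
  parities to one vertex would combine to an odd closed walk. \<open>SOME\<close> picks the same
  root throughout a component.\<close>

lemma two_colouring_if_no_odd_closed_walk:
  assumes "sym R" and no_odd: "\<And>x n. odd n \<Longrightarrow> (x, x) \<notin> R ^^ n"
  obtains A where "\<forall>(x, y)\<in>R. x \<in> A \<longleftrightarrow> y \<notin> A"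
proof -
  define root where "root x = (SOME r. (r, x) \<in> R\<^sup>*)" for x
  define A where "A = {x. \<exists>n. even n \<and> (root x, x) \<in> R ^^ n}"
  have root: "(root x, x) \<in> R\<^sup>*" for x
    unfolding root_def by (rule someI[of _ x]) simp
  have "x \<in> A \<longleftrightarrow> y \<notin> A" if xy: "(x, y) \<in> R" for x y
  proof -
    have "(r, x) \<in> R\<^sup>* \<longleftrightarrow> (r, y) \<in> R\<^sup>*" for r
      using xy \<open>sym R\<close> by (meson rtrancl.rtrancl_into_rtrancl symD)
    then have r: "root y = root x"
      by (simp add: root_def)
    obtain n where n: "(root x, x) \<in> R ^^ n"
      using root by (meson rtrancl_imp_relpow)
    have step: "(root x, y) \<in> R ^^ Suc k" if "(root x, x) \<in> R ^^ k" for k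
      using that xy by auto
    have parity: "even k \<longleftrightarrow> odd l" if "(root x, x) \<in> R ^^ k" "(root x, y) \<in> R ^^ l" for k l
    proof -
      have "(root x, root x) \<in> R ^^ (Suc k + l)"
        unfolding relpow_add using step[OF that(1)] relpow_sym[OF \<open>sym R\<close> that(2)] by blast
      then show ?thesis
        using no_odd[of "Suc k + l" "root x"] by auto
    qed
    show ?thesis
    proof (cases "even n")
      case True
      then have "x \<in> A"
        using n by (auto simp: A_def)
      moreover have "y \<notin> A"
        using True n parity by (auto simp: A_def r)
      ultimately show ?thesis by simp
    next
      case False
      then have "y \<in> A"
        using step[OF n] unfolding A_def mem_Collect_eq r by (intro exI[of _ "Suc n"]) simp
      moreover have "x \<notin> A"
        using False step[OF n] parity[of _ "Suc n"] by (auto simp: A_def)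
      ultimately show ?thesis by simp
    qed
  qed
  then show ?thesis
    by (intro that[of A]) auto
qed

text \<open>A shortest odd closed walk, unrolled periodically, has no chords: a chord would split it into
  two closed walks, one of them odd and shorter.\<close>
lemma shortest_odd_closed_walk:
  assumes "sym R" and "(x, x) \<in> R ^^ k" "odd k"
  obtains f :: "nat \<Rightarrow> 'a" and n where "odd n" "\<forall>i. f (i + n) = f i"
    "\<forall>i. (f i, f (i + 1)) \<in> R" "\<forall>i d. 0 < d \<and> d < n \<longrightarrow> f i \<noteq> f (i + d)"
    "\<forall>i d. 0 < d \<and> d < n \<and> (f i, f (i + d)) \<in> R \<longrightarrow> d = 1 \<or> d = n - 1"
proof -
  define n where "n = (LEAST n. odd n \<and> (\<exists>x. (x, x) \<in> R ^^ n))"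
  have "odd n \<and> (\<exists>x. (x, x) \<in> R ^^ n)"
    unfolding n_def by (rule LeastI[of _ k]) (use assms in blast)
  then obtain x0 where n: "odd n" "(x0, x0) \<in> R ^^ n"
    by blast
  have minimal: "n \<le> m" if "odd m" "(y, y) \<in> R ^^ m" for m y
    unfolding n_def by (rule Least_le) (use that in blast)
  obtain g where g: "g 0 = x0" "g n = x0" "\<And>i. i < n \<Longrightarrow> (g i, g (Suc i)) \<in> R"
    using n(2) unfolding relpow_fun_conv by blast
  have "0 < n"
    using n(1) odd_pos by blast
  define f where "f i = g (i mod n)" for i
  have per: "f (i + n) = f i" for i
    by (simp add: f_def)
  have step: "(f i, f (i + 1)) \<in> R" for i
  proof (cases "Suc (i mod n) = n")
    case True
    then have "f (i + 1) = g n"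
      using g by (simp add: f_def mod_Suc)
    then show ?thesis
      using g(3)[of "i mod n"] True by (simp add: f_def)
  next
    case False
    then show ?thesis
      using g(3)[of "i mod n"] \<open>0 < n\<close> by (simp add: f_def mod_Suc)
  qed
  have walk: "(f i, f (i + d)) \<in> R ^^ d" for i d
    using step[of "i + _"] by (induction d) auto
  have walk_back: "(f (i + d), f i) \<in> R ^^ (n - d)" if "d < n" for i d
    using walk[of "i + d" "n - d"] per[of i] that by simp
  have distinct: "f i \<noteq> f (i + d)" if "0 < d" "d < n" for i d
  proof
    assume "f i = f (i + d)"
    then have "(f i, f i) \<in> R ^^ d" "(f i, f i) \<in> R ^^ (n - d)"
      using walk[of i d] walk_back[of d i] that by auto
    moreover have "odd d \<or> odd (n - d)"
      using n(1) that by auto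
    ultimately show False
      using minimal[of d] minimal[of "n - d"] that by fastforce
  qed
  have "d = 1 \<or> d = n - 1" if "0 < d" "d < n" "(f i, f (i + d)) \<in> R" for i d
  proof (rule ccontr)
    assume *: "\<not> (d = 1 \<or> d = n - 1)"
    have "(f (i + d), f i) \<in> R"
      using that(3) \<open>sym R\<close> by (meson symD)
    then have "(f i, f i) \<in> R ^^ Suc d"
      using walk[of i d] by auto
    moreover have "(f (i + d), f (i + d)) \<in> R ^^ Suc (n - d)"
      using walk_back[OF that(2), of i] that(3) by auto
    moreover have "odd (Suc d) \<or> odd (Suc (n - d))"
      using n(1) that by auto
    ultimately have "n \<le> Suc d \<or> n \<le> Suc (n - d)"
      using minimal by blast
    then show False
      using * that(1,2) by linarith
  qed
  then have "\<forall>i d. 0 < d \<and> d < n \<and> (f i, f (i + d)) \<in> R \<longrightarrow> d = 1 \<or> d = n - 1"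
    by blast
  then show ?thesis
    using n(1) per step distinct by (intro that[of n f]) simp_all
qed

context perfect_facet_graph
begin

text \<open>Nonadjacency inside the neighbourhood of \<open>z\<close> is not bipartite, and a
  shortest odd closed walk in it is an antihole of \<open>E\<close>. Length 1 is a loop, length 3 is
  a claw at \<open>z\<close>, and length at least 7 is excluded.\<close>

lemma hole_in_neighborhood:
  assumes "\<not> quasi_line E"
  obtains z c1 c2 c3 c4 c5 where "hole5 c1 c2 c3 c4 c5"
    "E z c1" "E z c2" "E z c3" "E z c4" "E z c5"
proof -
  obtain z where z: "\<nexists>A B. A \<union> B = neighborhood E z \<and> A \<inter> B = {} \<and> clique E A \<and> clique E B"
    using assms unfolding quasi_line_def not_all by (elim exE)
  define R where "R = {(x, y). E z x \<and> E z y \<and> x \<noteq> y \<and> \<not> E x y}"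
  have "sym R"
    using adj_sym by (auto simp: R_def sym_def)
  have "\<exists>x k. odd k \<and> (x, x) \<in> R ^^ k"
  proof (rule ccontr)
    assume "\<not> ?thesis"
    then have no_odd: "(x, x) \<notin> R ^^ k" if "odd k" for x k
      using that by blast
    obtain A where A: "\<forall>(x, y)\<in>R. x \<in> A \<longleftrightarrow> y \<notin> A"
      by (rule two_colouring_if_no_odd_closed_walk[OF \<open>sym R\<close> no_odd])
    let ?N = "neighborhood E z"
    have "clique E (?N \<inter> A)" "clique E (?N - A)"
      using A by (auto simp: clique_def neighborhood_def R_def)
    moreover have "?N \<inter> A \<union> (?N - A) = ?N" "(?N \<inter> A) \<inter> (?N - A) = {}"
      by auto
    ultimately show False
      using z by blast
  qed
  then obtain x k where "(x, x) \<in> R ^^ k" "odd k"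
    by blast
  then obtain f :: "nat \<Rightarrow> 'n" and n where f: "odd n" "\<forall>i. f (i + n) = f i"
    "\<forall>i. (f i, f (i + 1)) \<in> R" "\<forall>i d. 0 < d \<and> d < n \<longrightarrow> f i \<noteq> f (i + d)"
    "\<forall>i d. 0 < d \<and> d < n \<and> (f i, f (i + d)) \<in> R \<longrightarrow> d = 1 \<or> d = n - 1"
    by (rule shortest_odd_closed_walk[OF \<open>sym R\<close>])
  have nbr: "E z (f i)" and step: "\<not> E (f i) (f (i + 1))" for i
    using f(3)[THEN spec, of i] by (auto simp: R_def)
  have adj: "E (f i) (f (i + d)) \<longleftrightarrow> d \<noteq> 1 \<and> d \<noteq> n - 1" if "0 < d" "d < n" for i d
  proof
    assume "E (f i) (f (i + d))"
    moreover have "\<not> E (f i) (f (i + (n - 1)))"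
    proof -
      have "i + (n - 1) + 1 = i + n"
        using that by simp
      then show ?thesis
        using step[of "i + (n - 1)"] f(2) adj_sym by metis
    qed
    ultimately show "d \<noteq> 1 \<and> d \<noteq> n - 1"
      using step[of i] by metis
  next
    assume "d \<noteq> 1 \<and> d \<noteq> n - 1"
    then show "E (f i) (f (i + d))"
      using f(4,5) that nbr unfolding R_def by blast
  qed
  have "n \<noteq> 1"
    using f(2)[THEN spec, of 0] f(3)[THEN spec, of 0] by (auto simp: R_def)
  moreover have "n \<noteq> 3"
  proof
    assume "n = 3"
    then show False
      using no_claw[of z "f 0" "f 1" "f 2"] nbr adj[of 1 0] adj[of 2 0] adj[of 1 1]
        f(4)[rule_format, of 1 0] f(4)[rule_format, of 2 0] f(4)[rule_format, of 1 1] by (simp add: numeral_eq_Suc)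
  qed
  moreover have "\<not> 7 \<le> n"
    using no_long_odd_antihole[OF f(1) _ f(2)[rule_format] adj] by blast
  ultimately have "n = 5"
    using f(1) by presburger
  then have "E (f i) (f (i + 2))" "E (f i) (f (i + 3))" "\<not> E (f i) (f (i + 1))" "\<not> E (f i) (f (i + 4))" for i
    using adj[of 2 i] adj[of 3 i] adj[of 1 i] adj[of 4 i] by auto
  \<comment> \<open>The complement of a 5-cycle is the 5-cycle traversed in steps of two.\<close>
  from this[of 0] this[of 1] this[of 2] this[of 3] have "hole5 (f 0) (f 2) (f 4) (f 1) (f 3)"
    unfolding hole5_def using adj_sym by (simp add: numeral_eq_Suc) blast
  then show ?thesis
    using that nbr by blast
qed

subsection \<open>The structure around a 5-wheel\<close>

lemma adj_commute: "E i j \<longleftrightarrow> E j i"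
  using adj_sym by blast

text \<open>Attachment to the rim edge \<open>c1 c2\<close>; rotating the arguments addresses the
  other rim edges. Likewise \<open>wheel v\<close> with the same rim expresses that \<open>v\<close>
  is a further hub.\<close>

definition rim_pair :: "'n \<Rightarrow> 'n \<Rightarrow> 'n \<Rightarrow> 'n \<Rightarrow> 'n \<Rightarrow> 'n \<Rightarrow> bool" where
  "rim_pair c1 c2 c3 c4 c5 t \<longleftrightarrow> E t c1 \<and> E t c2 \<and> \<not> E t c3 \<and> \<not> E t c4 \<and> \<not> E t c5"

definition wheel :: "'n \<Rightarrow> 'n \<Rightarrow> 'n \<Rightarrow> 'n \<Rightarrow> 'n \<Rightarrow> 'n \<Rightarrow> bool" where
  "wheel z c1 c2 c3 c4 c5 \<longleftrightarrow>
     hole5 c1 c2 c3 c4 c5 \<and> E z c1 \<and> E z c2 \<and> E z c3 \<and> E z c4 \<and> E z c5"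

definition far :: "'n \<Rightarrow> 'n \<Rightarrow> 'n \<Rightarrow> 'n \<Rightarrow> 'n \<Rightarrow> 'n \<Rightarrow> bool" where
  "far c1 c2 c3 c4 c5 v \<longleftrightarrow> \<not> E v c1 \<and> \<not> E v c2 \<and> \<not> E v c3 \<and> \<not> E v c4 \<and> \<not> E v c5"

lemma wheel_rotate: "wheel z c1 c2 c3 c4 c5 \<Longrightarrow> wheel z c2 c3 c4 c5 c1"
  by (simp add: wheel_def hole5_def adj_commute)

lemma far_rotate: "far c1 c2 c3 c4 c5 v \<Longrightarrow> far c2 c3 c4 c5 c1 v"
  by (simp add: far_def)

lemma wheel_adj:
  assumes "wheel z c1 c2 c3 c4 c5"
  shows "E c1 c2" "E c2 c3" "E c3 c4" "E c4 c5" "E c5 c1"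
    "E c2 c1" "E c3 c2" "E c4 c3" "E c5 c4" "E c1 c5"
    "\<not> E c1 c3" "\<not> E c1 c4" "\<not> E c2 c4" "\<not> E c2 c5" "\<not> E c3 c5"
    "\<not> E c3 c1" "\<not> E c4 c1" "\<not> E c4 c2" "\<not> E c5 c2" "\<not> E c5 c3"
    "E z c1" "E z c2" "E z c3" "E z c4" "E z c5" "E c1 z" "E c2 z" "E c3 z" "E c4 z" "E c5 z"
    "distinct [z, c1, c2, c3, c4, c5]"
  using assms adj_irrefl by (auto simp: wheel_def hole5_def adj_commute)

lemma rim_pair_adj:
  assumes "rim_pair c1 c2 c3 c4 c5 t"
  shows "E t c1" "E t c2" "\<not> E t c3" "\<not> E t c4" "\<not> E t c5"
    "E c1 t" "E c2 t" "\<not> E c3 t" "\<not> E c4 t" "\<not> E c5 t"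
  using assms by (simp_all add: rim_pair_def adj_commute)

text \<open>A vertex that sees \<open>c1\<close> but neither \<open>c2\<close> nor \<open>c5\<close>
  gives a claw at \<open>c1\<close>, so its neighbours on the rim come in runs of at least two. Runs
  of three and four are the forbidden subgraphs.\<close>

lemma wheel_classification:
  assumes "wheel z c1 c2 c3 c4 c5"
  shows "v \<in> {c1, c2, c3, c4, c5} \<or> wheel v c1 c2 c3 c4 c5 \<or> far c1 c2 c3 c4 c5 v \<or>
    rim_pair c1 c2 c3 c4 c5 v \<or> rim_pair c2 c3 c4 c5 c1 v \<or> rim_pair c3 c4 c5 c1 c2 v \<or>
    rim_pair c4 c5 c1 c2 c3 v \<or> rim_pair c5 c1 c2 c3 c4 v"
proof (cases "v \<in> {c1, c2, c3, c4, c5}")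
  case False
  have claw: "E v c1 \<Longrightarrow> E v c2 \<or> E v c5" and deg3: "\<not> (E v c1 \<and> E v c2 \<and> E v c3 \<and> \<not> E v c4 \<and> \<not> E v c5)"
    and deg4: "\<not> (E v c1 \<and> E v c2 \<and> E v c3 \<and> E v c4 \<and> \<not> E v c5)"
    if "wheel z c1 c2 c3 c4 c5" "v \<notin> {c1, c2, c3, c4, c5}" for c1 c2 c3 c4 c5
  proof -
    note w = wheel_adj[OF that(1)]
    show "E v c1 \<Longrightarrow> E v c2 \<or> E v c5"
      using no_claw[of c1 v c2 c5] w that(2) by (auto simp: adj_commute)
    show "\<not> (E v c1 \<and> E v c2 \<and> E v c3 \<and> \<not> E v c4 \<and> \<not> E v c5)"
      using no_hole_plus_degree_3 that(1) unfolding wheel_def by blast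
    show "\<not> (E v c1 \<and> E v c2 \<and> E v c3 \<and> E v c4 \<and> \<not> E v c5)"
      using no_hole_plus_degree_4 that(1) unfolding wheel_def by blast
  qed
  note r1 = assms
  note r2 = wheel_rotate[OF r1]
  note r3 = wheel_rotate[OF r2]
  note r4 = wheel_rotate[OF r3]
  note r5 = wheel_rotate[OF r4]
  have v: "v \<notin> {c2, c3, c4, c5, c1}" "v \<notin> {c3, c4, c5, c1, c2}" "v \<notin> {c4, c5, c1, c2, c3}"
    "v \<notin> {c5, c1, c2, c3, c4}"
    using False by auto
  show ?thesis
    using claw[OF r1 False] claw[OF r2 v(1)] claw[OF r3 v(2)] claw[OF r4 v(3)] claw[OF r5 v(4)]
      deg3[OF r1 False] deg3[OF r2 v(1)] deg3[OF r3 v(2)] deg3[OF r4 v(3)] deg3[OF r5 v(4)]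
      deg4[OF r1 False] deg4[OF r2 v(1)] deg4[OF r3 v(2)] deg4[OF r4 v(3)] deg4[OF r5 v(4)] r1
    unfolding wheel_def far_def rim_pair_def by argo
qed simp

section \<open>Adjacency between hubs, rim pairs and far vertices\<close>

lemma hub_rim_pair:
  assumes "wheel z c1 c2 c3 c4 c5" "rim_pair c1 c2 c3 c4 c5 t"
  shows "\<not> E z t"
  using no_claw[of z t c3 c5] wheel_adj[OF assms(1)] rim_pair_adj[OF assms(2)] by auto

lemma hub_far:
  assumes "wheel z c1 c2 c3 c4 c5" "far c1 c2 c3 c4 c5 v"
  shows "\<not> E z v"
  using no_claw[of z v c1 c3] wheel_adj[OF assms(1)] assms(2) unfolding far_def by auto

lemma same_rim_pair_adj:
  assumes "wheel z c1 c2 c3 c4 c5" "rim_pair c1 c2 c3 c4 c5 t" "rim_pair c1 c2 c3 c4 c5 t'" "t \<noteq> t'"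
  shows "E t t'"
  using no_claw[of c1 t t' z] wheel_adj[OF assms(1)] rim_pair_adj[OF assms(2)] rim_pair_adj[OF assms(3)]
    hub_rim_pair[OF assms(1,2)] hub_rim_pair[OF assms(1,3)] assms(4) by (auto simp: adj_commute)

lemma next_rim_pair_adj:
  assumes "wheel z c1 c2 c3 c4 c5" "rim_pair c1 c2 c3 c4 c5 t" "rim_pair c2 c3 c4 c5 c1 t'"
  shows "E t t'"
  using no_claw[of c2 t t' z] wheel_adj[OF assms(1)] rim_pair_adj[OF assms(2)] rim_pair_adj[OF assms(3)]
    hub_rim_pair[OF assms(1,2)] hub_rim_pair[OF wheel_rotate[OF assms(1)] assms(3)] by (auto simp: adj_commute)

text \<open>Otherwise \<open>t\<close> and \<open>t'\<close> close the path \<open>c1 c5 c4\<close>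
  to a 5-hole, of which \<open>z\<close> sees exactly that path.\<close>

lemma second_next_rim_pair_not_adj:
  assumes "wheel z c1 c2 c3 c4 c5" "rim_pair c1 c2 c3 c4 c5 t" "rim_pair c3 c4 c5 c1 c2 t'"
  shows "\<not> E t t'"
proof
  assume "E t t'"
  note facts = wheel_adj[OF assms(1)] rim_pair_adj[OF assms(2)] rim_pair_adj[OF assms(3)] adj_sym[OF \<open>E t t'\<close>]
  have "hole5 c1 c5 c4 t' t"
    unfolding hole5_def by (simp add: facts)
  then show False
    by (rule no_hole_plus_degree_3[of _ _ _ _ _ z])
      (use facts hub_rim_pair[OF assms(1,2)]
        hub_rim_pair[OF wheel_rotate[OF wheel_rotate[OF assms(1)]] assms(3)] in auto)
qed

text \<open>Otherwise \<open>v\<close>, \<open>t\<close>, \<open>c3\<close>, \<open>c5\<close> would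
  be a stable quadruple.\<close>

lemma far_rim_pair:
  assumes "wheel z c1 c2 c3 c4 c5" "rim_pair c1 c2 c3 c4 c5 t" "far c1 c2 c3 c4 c5 v"
  shows "E v t"
  using no_stable_quadruple[of v t c3 c5] wheel_adj[OF assms(1)] rim_pair_adj[OF assms(2)] assms(3)
  by (auto simp: far_def)

text \<open>The triangles \<open>c2 c1 t\<close> and \<open>c3 c4 t'\<close> are linked by the edge
  \<open>c2 c3\<close> and by paths through \<open>c5\<close> and \<open>v\<close>.\<close>

lemma no_far_with_second_next_rim_pairs:
  assumes "wheel z c1 c2 c3 c4 c5" "rim_pair c1 c2 c3 c4 c5 t" "rim_pair c3 c4 c5 c1 c2 t'"
    "far c1 c2 c3 c4 c5 v"
  shows False
proof -
  have "far c3 c4 c5 c1 c2 v"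
    using assms(4) by (simp add: far_def)
  then have vt: "E v t" "E v t'"
    using far_rim_pair[OF assms(1,2,4)] far_rim_pair[OF wheel_rotate[OF wheel_rotate[OF assms(1)]] assms(3)]
    by blast+
  show False
    by (rule no_linked_triangles[of c2 c3 c1 t c4 t' c5 v])
      (use wheel_adj[OF assms(1)] rim_pair_adj[OF assms(2)] rim_pair_adj[OF assms(3)] vt
        vt[THEN adj_sym] second_next_rim_pair_not_adj[OF assms(1-3)] assms(4) in
        \<open>auto simp: far_def adj_commute\<close>)
qed

text \<open>The triangles \<open>z c1 c5\<close> and \<open>c3 t2 t3\<close> are linked by the edge
  \<open>z c3\<close> and by paths through \<open>t1\<close> and \<open>t4\<close>.\<close>

lemma no_four_consecutive_rim_pairs:
  assumes wheel: "wheel z c1 c2 c3 c4 c5"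
    and ex: "\<exists>v. rim_pair c1 c2 c3 c4 c5 v" "\<exists>v. rim_pair c2 c3 c4 c5 c1 v"
      "\<exists>v. rim_pair c3 c4 c5 c1 c2 v" "\<exists>v. rim_pair c4 c5 c1 c2 c3 v"
  shows False
proof -
  obtain t1 t2 t3 t4 where t: "rim_pair c1 c2 c3 c4 c5 t1" "rim_pair c2 c3 c4 c5 c1 t2"
    "rim_pair c3 c4 c5 c1 c2 t3" "rim_pair c4 c5 c1 c2 c3 t4"
    using ex by blast
  note w2 = wheel_rotate[OF wheel]
  note w3 = wheel_rotate[OF w2]
  note w4 = wheel_rotate[OF w3]
  have tt: "E t1 t2" "E t2 t3" "E t3 t4" "\<not> E t1 t3" "\<not> E t2 t4" "\<not> E t4 t1"
    using next_rim_pair_adj[OF wheel t(1,2)] next_rim_pair_adj[OF w2 t(2,3)]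
      next_rim_pair_adj[OF w3 t(3,4)] second_next_rim_pair_not_adj[OF wheel t(1,3)]
      second_next_rim_pair_not_adj[OF w2 t(2,4)] second_next_rim_pair_not_adj[OF w4 t(4,1)]
    by auto
  have zt: "\<not> E z t1" "\<not> E z t2" "\<not> E z t3" "\<not> E z t4"
    using hub_rim_pair[OF wheel t(1)] hub_rim_pair[OF w2 t(2)] hub_rim_pair[OF w3 t(3)]
      hub_rim_pair[OF w4 t(4)] by auto
  show False
    by (rule no_linked_triangles[of z c3 c1 c5 t2 t3 t1 t4])
      (use wheel_adj[OF wheel] rim_pair_adj[OF t(1)] rim_pair_adj[OF t(2)] rim_pair_adj[OF t(3)]
        rim_pair_adj[OF t(4)] tt zt in \<open>auto simp: adj_commute\<close>)
qed

text \<open>Without rim pairs, connectedness leaves only rim and hubs. A stable triple then lies in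
  the rim, which has stability number 2, or consists of hubs and gives a claw at
  \<open>c1\<close>.\<close>

lemma rim_pair_exists:
  assumes "wheel z c1 c2 c3 c4 c5"
  shows "\<exists>v. rim_pair c1 c2 c3 c4 c5 v \<or> rim_pair c2 c3 c4 c5 c1 v \<or> rim_pair c3 c4 c5 c1 c2 v \<or>
    rim_pair c4 c5 c1 c2 c3 v \<or> rim_pair c5 c1 c2 c3 c4 v"
proof (rule ccontr)
  assume none: "\<not> ?thesis"
  note w = wheel_adj[OF assms]
  have cases: "v \<in> {c1, c2, c3, c4, c5} \<or> wheel v c1 c2 c3 c4 c5 \<or> far c1 c2 c3 c4 c5 v" for v
    using wheel_classification[OF assms, of v] none by blast
  have far_closed: "\<not> E u v" if "u \<in> Collect (far c1 c2 c3 c4 c5)" "v \<notin> Collect (far c1 c2 c3 c4 c5)" for u v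
    using cases[of v] that hub_far[of v c1 c2 c3 c4 c5 u] adj_sym[of u v] by (auto simp: far_def)
  have "c1 \<notin> Collect (far c1 c2 c3 c4 c5)"
    using w by (simp add: far_def)
  then have no_far: "\<not> far c1 c2 c3 c4 c5 v" for v
    using no_separation[OF _ \<open>c1 \<notin> _\<close> far_closed, of v] by blast
  obtain x y u where *: "x \<noteq> y" "x \<noteq> u" "y \<noteq> u" "\<not> E x y" "\<not> E x u" "\<not> E y u"
    by (rule stable_triple)
  have hub: "v \<in> {c1, c2, c3, c4, c5} \<or> (\<forall>c\<in>{c1, c2, c3, c4, c5}. E v c \<and> E c v)" for v
    using cases[of v] no_far by (auto simp: wheel_def adj_commute)
  show False
  proof (cases "x \<in> {c1, c2, c3, c4, c5} \<or> y \<in> {c1, c2, c3, c4, c5} \<or> u \<in> {c1, c2, c3, c4, c5}")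
    case True
    then have "x \<in> {c1, c2, c3, c4, c5}" "y \<in> {c1, c2, c3, c4, c5}" "u \<in> {c1, c2, c3, c4, c5}"
      using hub[of x] hub[of y] hub[of u] * by blast+
    then show False
      using * w by auto
  next
    case False
    then have "E c1 x" "E c1 y" "E c1 u"
      using hub[of x] hub[of y] hub[of u] by blast+
    then show False
      using no_claw * by blast
  qed
qed

section \<open>Facets of two or three intersecting 5-wheels\<close>

lemma weight_triple_le:
  assumes "distinct [x, y, w]" "\<not> E x y" "\<not> E x w" "\<not> E y w"
  shows "a $ x + a $ y + a $ w \<le> b"
proof -
  have "stable_set E {x, y, w}"
    using assms(2-4) adj_irrefl by (auto simp: stable_set_def adj_commute)
  then have "weight a {x, y, w} \<le> b"
    by (rule weight_le)
  then show ?thesis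
    using assms(1) by (simp add: weight_def)
qed

lemma weight_sum_list:
  assumes "UNIV = set vs" "distinct vs"
  shows "weight c S = (\<Sum>v\<leftarrow>vs. if v \<in> S then c $ v else 0)"
proof -
  have "weight c S = (\<Sum>v\<in>UNIV. if v \<in> S then c $ v else 0)"
    by (simp add: weight_def sum.If_cases)
  then show ?thesis
    using assms by (simp add: sum_list_distinct_conv_sum_set)
qed

lemma tight_not_adj: "tight S \<Longrightarrow> u \<in> S \<Longrightarrow> v \<in> S \<Longrightarrow> \<not> E u v"
  by (simp add: tight_def stable_set_def)

lemma tight_dominates: "tight S \<Longrightarrow> v \<in> S \<or> (\<exists>u\<in>S. E u v)"
  using tight_maximal by blast

text \<open>The wheels have hubs \<open>z\<close> and \<open>c2\<close>.  A facet with full support has, for each clique and wheel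
  inequality, a tight stable set at which that inequality is strict; a few of these sets already
  satisfy incompatible linear relations.\<close>
lemma not_gear:
  assumes univ: "UNIV = set [z, c1, c2, c3, c4, c5, t1, t2]"
    and dist: "distinct [z, c1, c2, c3, c4, c5, t1, t2]"
    and wheel: "wheel z c1 c2 c3 c4 c5"
    and t: "rim_pair c1 c2 c3 c4 c5 t1" "rim_pair c2 c3 c4 c5 c1 t2"
  shows False
proof -
  note adjs = wheel_adj(1-30)[OF wheel] rim_pair_adj[OF t(1)] rim_pair_adj[OF t(2)]
    next_rim_pair_adj[OF wheel t] next_rim_pair_adj[OF wheel t, THEN adj_sym]
    hub_rim_pair[OF wheel t(1)] hub_rim_pair[OF wheel_rotate[OF wheel] t(2)]
    hub_rim_pair[OF wheel t(1), unfolded adj_commute[of z]]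
    hub_rim_pair[OF wheel_rotate[OF wheel] t(2), unfolded adj_commute[of z]]
  have excl: "z \<in> S \<longrightarrow> c1 \<notin> S \<and> c2 \<notin> S \<and> c3 \<notin> S \<and> c4 \<notin> S \<and> c5 \<notin> S"
    "c1 \<in> S \<longrightarrow> c2 \<notin> S \<and> c5 \<notin> S \<and> t1 \<notin> S" "c2 \<in> S \<longrightarrow> c3 \<notin> S \<and> t1 \<notin> S \<and> t2 \<notin> S"
    "c3 \<in> S \<longrightarrow> c4 \<notin> S \<and> t2 \<notin> S" "c4 \<in> S \<longrightarrow> c5 \<notin> S" "t1 \<in> S \<longrightarrow> t2 \<notin> S"
    if "tight S" for S
    using tight_not_adj[OF that] adjs by blast+
  have dom: "t1 \<in> S \<or> t2 \<in> S \<or> c1 \<in> S \<or> c2 \<in> S" "t2 \<in> S \<or> t1 \<in> S \<or> c2 \<in> S \<or> c3 \<in> S"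
    "z \<in> S \<or> c1 \<in> S \<or> c2 \<in> S \<or> c3 \<in> S \<or> c4 \<in> S \<or> c5 \<in> S"
    "c1 \<in> S \<or> z \<in> S \<or> c2 \<in> S \<or> c5 \<in> S \<or> t1 \<in> S" "c3 \<in> S \<or> z \<in> S \<or> c2 \<in> S \<or> c4 \<in> S \<or> t2 \<in> S"
    "c4 \<in> S \<or> z \<in> S \<or> c3 \<in> S \<or> c5 \<in> S" "c5 \<in> S \<or> z \<in> S \<or> c1 \<in> S \<or> c4 \<in> S"
    if "tight S" for S
  proof -
    have nb: "v \<in> S \<or> (\<exists>u\<in>{z, c1, c2, c3, c4, c5, t1, t2}. u \<in> S \<and> E u v)" for v
      using tight_dominates[OF that, of v] univ by auto
    show "t1 \<in> S \<or> t2 \<in> S \<or> c1 \<in> S \<or> c2 \<in> S"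
      using nb[of t1] adjs by auto
    show "t2 \<in> S \<or> t1 \<in> S \<or> c2 \<in> S \<or> c3 \<in> S"
      using nb[of t2] adjs by auto
    show "z \<in> S \<or> c1 \<in> S \<or> c2 \<in> S \<or> c3 \<in> S \<or> c4 \<in> S \<or> c5 \<in> S"
      using nb[of z] adjs by auto
    show "c1 \<in> S \<or> z \<in> S \<or> c2 \<in> S \<or> c5 \<in> S \<or> t1 \<in> S"
      using nb[of c1] adjs by auto
    show "c3 \<in> S \<or> z \<in> S \<or> c2 \<in> S \<or> c4 \<in> S \<or> t2 \<in> S"
      using nb[of c3] adjs by auto
    show "c4 \<in> S \<or> z \<in> S \<or> c3 \<in> S \<or> c5 \<in> S"
      using nb[of c4] adjs by auto
    show "c5 \<in> S \<or> z \<in> S \<or> c1 \<in> S \<or> c4 \<in> S"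
      using nb[of c5] adjs by auto
  qed
  have weight_b: "(\<Sum>v\<leftarrow>[z, c1, c2, c3, c4, c5, t1, t2]. if v \<in> S then a $ v else 0) = b" if "tight S" for S
    using weight_sum_list[OF univ dist, of a S] that by (simp add: tight_def)
  \<comment> \<open>A tight set avoiding this triangle can dominate \<open>t1\<close> and
    \<open>t2\<close> only by \<open>c1\<close> and \<open>c3\<close>.\<close>
  have "clique E {c2, t1, t2}"
    using adjs by (simp add: clique_def adj_commute)
  moreover have "z \<notin> {c2, t1, t2}"
    using dist by simp
  ultimately obtain S where S: "tight S" "S \<inter> {c2, t1, t2} = {}"
    using tight_avoiding_clique by (metis insert_not_empty)
  then have "c1 \<in> S" "c3 \<in> S"
    using dom[OF S(1)] by auto
  then have c13: "a $ c1 + a $ c3 = b"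
    using weight_b[OF S(1)] excl[OF S(1)] S(2) by simp
  \<comment> \<open>The left-hand side of the wheel inequality with hub \<open>c2\<close>, rim
    \<open>z\<close>, \<open>c1\<close>, \<open>t1\<close>, \<open>t2\<close>, \<open>c3\<close> and
    right-hand side 2.\<close>
  define c :: "real^'n" where "c = (\<chi> v. if v = c2 then 2 else if v \<in> {c4, c5} then 0 else 1)"
  have c: "c $ z = 1" "c $ c1 = 1" "c $ c2 = 2" "c $ c3 = 1" "c $ c4 = 0" "c $ c5 = 0" "c $ t1 = 1" "c $ t2 = 1"
    using dist by (auto simp: c_def)
  then have "c \<noteq> 0"
    by (metis zero_index zero_neq_one)
  then obtain S' where S': "tight S'" "weight c S' \<noteq> 2"
    using tight_proper_face c(5) by blast
  have wc: "weight c S' = (if z \<in> S' then 1 else 0) + (if c1 \<in> S' then 1 else 0) + (if c2 \<in> S' then 2 else 0)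
      + (if c3 \<in> S' then 1 else 0) + (if t1 \<in> S' then 1 else 0) + (if t2 \<in> S' then 1 else 0)"
    unfolding weight_sum_list[OF univ dist] by (simp add: c cong: if_cong)
  note excl' = excl[OF S'(1)]
  have "\<not> (z \<in> S' \<and> t1 \<in> S')" "\<not> (z \<in> S' \<and> t2 \<in> S')" "\<not> (c1 \<in> S' \<and> t2 \<in> S')"
    "\<not> (c1 \<in> S' \<and> c3 \<in> S')" "\<not> (c3 \<in> S' \<and> t1 \<in> S')" "c2 \<notin> S'"
    using S'(2) excl' unfolding wc by auto
  then have cases: "c4 \<in> S' \<and> t1 \<in> S' \<and> S' \<inter> {z, c1, c2, c3, c5, t2} = {} \<or>
      c5 \<in> S' \<and> t2 \<in> S' \<and> S' \<inter> {z, c1, c2, c3, c4, t1} = {}"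
    using excl' dom[OF S'(1)] by auto
  then have "a $ c4 + a $ t1 = b \<or> a $ c5 + a $ t2 = b"
    using weight_b[OF S'(1)] by auto
  \<comment> \<open>In the first case these triples and \<open>c13\<close> give
    \<open>a $ t1 \<ge> a $ c1 + a $ t2\<close> and \<open>a $ c1 \<ge> a $ t1 + a $ c5\<close>,
    against positivity; the second case is its mirror image.\<close>
  moreover have "a $ c1 + a $ c4 + a $ t2 \<le> b" "a $ t1 + a $ c3 + a $ c5 \<le> b"
    by (rule weight_triple_le; use adjs dist in auto)+
  ultimately show False
    using c13 a_pos[of t2] a_pos[of c5] a_pos[of c4] a_pos[of t1] by linarith
qed

text \<open>The hubs are \<open>z\<close>, \<open>c2\<close> and \<open>c3\<close>. The linear
  relations come from two triangles at \<open>c3\<close> and from the wheel with hub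
  \<open>c3\<close> and rim \<open>z\<close>, \<open>c2\<close>, \<open>t2\<close>,
  \<open>t3\<close>, \<open>c4\<close>.\<close>

lemma not_gear_chain:
  assumes univ: "UNIV = set [z, c1, c2, c3, c4, c5, t1, t2, t3]"
    and dist: "distinct [z, c1, c2, c3, c4, c5, t1, t2, t3]"
    and wheel: "wheel z c1 c2 c3 c4 c5"
    and t: "rim_pair c1 c2 c3 c4 c5 t1" "rim_pair c2 c3 c4 c5 c1 t2" "rim_pair c3 c4 c5 c1 c2 t3"
  shows False
proof -
  note w2 = wheel_rotate[OF wheel]
  note tt = next_rim_pair_adj[OF wheel t(1,2)] next_rim_pair_adj[OF w2 t(2,3)]
  note zt = hub_rim_pair[OF wheel t(1)] hub_rim_pair[OF w2 t(2)] hub_rim_pair[OF wheel_rotate[OF w2] t(3)]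
  note t13 = second_next_rim_pair_not_adj[OF wheel t(1,3)]
  note adjs = wheel_adj(1-30)[OF wheel] rim_pair_adj[OF t(1)] rim_pair_adj[OF t(2)] rim_pair_adj[OF t(3)]
    tt tt[THEN adj_sym] t13 t13[unfolded adj_commute[of t1]] zt zt[unfolded adj_commute[of z]]
  have excl: "z \<in> S \<longrightarrow> c1 \<notin> S \<and> c2 \<notin> S \<and> c3 \<notin> S \<and> c4 \<notin> S \<and> c5 \<notin> S"
    "c1 \<in> S \<longrightarrow> c2 \<notin> S \<and> c5 \<notin> S \<and> t1 \<notin> S" "c2 \<in> S \<longrightarrow> c3 \<notin> S \<and> t1 \<notin> S \<and> t2 \<notin> S"
    "c3 \<in> S \<longrightarrow> c4 \<notin> S \<and> t2 \<notin> S \<and> t3 \<notin> S" "c4 \<in> S \<longrightarrow> c5 \<notin> S \<and> t3 \<notin> S"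
    "t2 \<in> S \<longrightarrow> t1 \<notin> S \<and> t3 \<notin> S"
    if "tight S" for S
    using tight_not_adj[OF that] adjs by blast+
  have dom: "t1 \<in> S \<or> t2 \<in> S \<or> c1 \<in> S \<or> c2 \<in> S" "t2 \<in> S \<or> t1 \<in> S \<or> t3 \<in> S \<or> c2 \<in> S \<or> c3 \<in> S"
    "t3 \<in> S \<or> t2 \<in> S \<or> c3 \<in> S \<or> c4 \<in> S"
    "z \<in> S \<or> c1 \<in> S \<or> c2 \<in> S \<or> c3 \<in> S \<or> c4 \<in> S \<or> c5 \<in> S"
    "c1 \<in> S \<or> z \<in> S \<or> c2 \<in> S \<or> c5 \<in> S \<or> t1 \<in> S"
    "c2 \<in> S \<or> z \<in> S \<or> c1 \<in> S \<or> c3 \<in> S \<or> t1 \<in> S \<or> t2 \<in> S"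
    "c4 \<in> S \<or> z \<in> S \<or> c3 \<in> S \<or> c5 \<in> S \<or> t3 \<in> S" "c5 \<in> S \<or> z \<in> S \<or> c1 \<in> S \<or> c4 \<in> S"
    if "tight S" for S
  proof -
    have nb: "v \<in> S \<or> (\<exists>u\<in>{z, c1, c2, c3, c4, c5, t1, t2, t3}. u \<in> S \<and> E u v)" for v
      using tight_dominates[OF that, of v] univ by auto
    show "t1 \<in> S \<or> t2 \<in> S \<or> c1 \<in> S \<or> c2 \<in> S"
      using nb[of t1] adjs by auto
    show "t2 \<in> S \<or> t1 \<in> S \<or> t3 \<in> S \<or> c2 \<in> S \<or> c3 \<in> S"
      using nb[of t2] adjs by auto
    show "t3 \<in> S \<or> t2 \<in> S \<or> c3 \<in> S \<or> c4 \<in> S"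
      using nb[of t3] adjs by auto
    show "z \<in> S \<or> c1 \<in> S \<or> c2 \<in> S \<or> c3 \<in> S \<or> c4 \<in> S \<or> c5 \<in> S"
      using nb[of z] adjs by auto
    show "c1 \<in> S \<or> z \<in> S \<or> c2 \<in> S \<or> c5 \<in> S \<or> t1 \<in> S"
      using nb[of c1] adjs by auto
    show "c2 \<in> S \<or> z \<in> S \<or> c1 \<in> S \<or> c3 \<in> S \<or> t1 \<in> S \<or> t2 \<in> S"
      using nb[of c2] adjs by auto
    show "c4 \<in> S \<or> z \<in> S \<or> c3 \<in> S \<or> c5 \<in> S \<or> t3 \<in> S"
      using nb[of c4] adjs by auto
    show "c5 \<in> S \<or> z \<in> S \<or> c1 \<in> S \<or> c4 \<in> S"
      using nb[of c5] adjs by auto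
  qed
  have weight_b: "(\<Sum>v\<leftarrow>[z, c1, c2, c3, c4, c5, t1, t2, t3]. if v \<in> S then a $ v else 0) = b" if "tight S" for S
    using weight_sum_list[OF univ dist, of a S] that by (simp add: tight_def)
  have "clique E {c3, c4, t3}" "clique E {c3, t2, t3}"
    using adjs by (simp_all add: clique_def adj_commute)
  moreover have "z \<notin> {c3, c4, t3}" "z \<notin> {c3, t2, t3}"
    using dist by simp_all
  ultimately obtain S S' where S: "tight S" "S \<inter> {c3, c4, t3} = {}" and S': "tight S'" "S' \<inter> {c3, t2, t3} = {}"
    using tight_avoiding_clique by (metis insert_not_empty)
  have "t2 \<in> S \<and> S \<inter> {c1, c2, c3, c4, t1, t3} = {} \<and> (z \<in> S \<and> c5 \<notin> S \<or> c5 \<in> S \<and> z \<notin> S)"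
    using S(2) excl[OF S(1)] dom[OF S(1)] by auto
  then have X: "a $ t2 + a $ z = b \<or> a $ t2 + a $ c5 = b"
    using weight_b[OF S(1)] by auto
  have "c4 \<in> S' \<and> S' \<inter> {z, c1, c3, c5, t2, t3} = {} \<and> (t1 \<in> S' \<and> c2 \<notin> S' \<or> c2 \<in> S' \<and> t1 \<notin> S')"
    using S'(2) excl[OF S'(1)] dom[OF S'(1)] by auto
  then have Y: "a $ c4 + a $ t1 = b \<or> a $ c4 + a $ c2 = b"
    using weight_b[OF S'(1)] by auto
  define c :: "real^'n" where "c = (\<chi> v. if v = c3 then 2 else if v \<in> {c1, c5, t1} then 0 else 1)"
  have c: "c $ z = 1" "c $ c1 = 0" "c $ c2 = 1" "c $ c3 = 2" "c $ c4 = 1" "c $ c5 = 0" "c $ t1 = 0"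
    "c $ t2 = 1" "c $ t3 = 1"
    using dist by (auto simp: c_def)
  then have "c \<noteq> 0"
    by (metis zero_index zero_neq_one)
  then obtain R where R: "tight R" "weight c R \<noteq> 2"
    using tight_proper_face c(2) by blast
  have wc: "weight c R = (if z \<in> R then 1 else 0) + (if c2 \<in> R then 1 else 0) + (if c3 \<in> R then 2 else 0)
      + (if c4 \<in> R then 1 else 0) + (if t2 \<in> R then 1 else 0) + (if t3 \<in> R then 1 else 0)"
    unfolding weight_sum_list[OF univ dist] by (simp add: c cong: if_cong)
  note excl' = excl[OF R(1)]
  have "\<not> (z \<in> R \<and> t2 \<in> R)" "\<not> (z \<in> R \<and> t3 \<in> R)" "\<not> (c2 \<in> R \<and> t3 \<in> R)"
    "\<not> (c2 \<in> R \<and> c4 \<in> R)" "\<not> (c4 \<in> R \<and> t2 \<in> R)" "c3 \<notin> R"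
    using R(2) excl' unfolding wc by auto
  then have "t3 \<in> R \<and> c1 \<in> R \<and> R \<inter> {z, c2, c3, c4, c5, t1, t2} = {} \<or>
      c4 \<in> R \<and> t1 \<in> R \<and> R \<inter> {z, c1, c2, c3, c5, t2, t3} = {} \<or>
      c5 \<in> R \<and> t1 \<in> R \<and> t3 \<in> R \<and> R \<inter> {z, c1, c2, c3, c4, t2} = {} \<or>
      c5 \<in> R \<and> t2 \<in> R \<and> R \<inter> {z, c1, c2, c3, c4, t1, t3} = {}"
    using excl' dom[OF R(1)] by auto
  then have "a $ c1 + a $ t3 = b \<or> a $ c4 + a $ t1 = b \<or> a $ c5 + a $ t1 + a $ t3 = b \<or>
      a $ c5 + a $ t2 = b"
    using weight_b[OF R(1)] by auto
  moreover have "a $ c1 + a $ c4 + a $ t2 \<le> b" "a $ c5 + a $ t1 + a $ t3 \<le> b"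
    "a $ t1 + a $ t3 + a $ z \<le> b" "a $ c2 + a $ c5 + a $ t3 \<le> b"
    by (rule weight_triple_le; use adjs dist in auto)+
  moreover have "0 < a $ c1" "0 < a $ c2" "0 < a $ c3" "0 < a $ c4" "0 < a $ c5" "0 < a $ z"
    "0 < a $ t1" "0 < a $ t2" "0 < a $ t3"
    by (rule a_pos)+
  \<comment> \<open>Both alternatives of \<open>X\<close> give
    \<open>a $ t2 \<ge> a $ t1 + a $ t3\<close>. With the triple \<open>c1\<close>,
    \<open>c4\<close>, \<open>t2\<close> this excludes \<open>a $ c4 + a $ t1 = b\<close>, so
    \<open>Y\<close> leaves \<open>a $ c4 + a $ c2 = b\<close>; each combination that remains
    contradicts positivity.\<close>
  ultimately show False
    using X Y by (elim disjE) linarith+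
qed

section \<open>Patterns of occupied rim edges\<close>

lemma isolated_rim_pair:
  assumes wheel: "wheel z c1 c2 c3 c4 c5" and no_far: "\<And>v. \<not> far c1 c2 c3 c4 c5 v"
    and t: "\<exists>v. rim_pair c1 c2 c3 c4 c5 v"
    and none: "\<nexists>v. rim_pair c2 c3 c4 c5 c1 v" "\<nexists>v. rim_pair c5 c1 c2 c3 c4 v"
  shows False
proof -
  let ?A = "Collect (rim_pair c1 c2 c3 c4 c5)"
  note w = wheel_adj[OF wheel]
  note w4 = wheel_rotate[OF wheel_rotate[OF wheel_rotate[OF wheel]]]
  show False
  \<comment> \<open>The rim edge \<open>c1 c2\<close> cuts off its own class, since both
    neighbouring classes are empty and everything else misses it.\<close>
  proof (rule no_clique_cutset[of ?A "{c1, c2}" "- (?A \<union> {c1, c2})"])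
    show "?A \<inter> {c1, c2} = {}"
      using adj_irrefl by (auto simp: rim_pair_def)
    show "clique E {c1, c2}"
      using w by (simp add: clique_def)
    have "z \<in> - (?A \<union> {c1, c2})"
      using w by (auto simp: rim_pair_def)
    then show "- (?A \<union> {c1, c2}) \<noteq> {}"
      by blast
    show "?A \<noteq> {}"
      using t by blast
    fix u v
    assume u: "u \<in> ?A" and v: "v \<in> - (?A \<union> {c1, c2})"
    consider "v \<in> {c3, c4, c5}" | "wheel v c1 c2 c3 c4 c5" | "rim_pair c3 c4 c5 c1 c2 v"
      | "rim_pair c4 c5 c1 c2 c3 v"
      using wheel_classification[OF wheel, of v] v no_far[of v] none by blast
    then show "\<not> E u v"
    proof cases
      case 1
      then show ?thesis
        using u by (auto simp: rim_pair_def)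
    next
      case 2
      then show ?thesis
        using u hub_rim_pair adj_sym by blast
    next
      case 3
      then show ?thesis
        using u second_next_rim_pair_not_adj[OF wheel] by blast
    next
      case 4
      then show ?thesis
        using u second_next_rim_pair_not_adj[OF w4 4] adj_sym by blast
    qed
  qed auto
qed

text \<open>A second member of a class, or a second hub, would see exactly three consecutive
  vertices of a 5-hole around \<open>c2\<close> or \<open>c3\<close>. So no vertex is multiplied,
  and the graph has eight or nine vertices.\<close>

lemma two_or_three_consecutive_rim_pairs:
  assumes wheel: "wheel z c1 c2 c3 c4 c5" and no_far: "\<And>v. \<not> far c1 c2 c3 c4 c5 v"
    and ex: "\<exists>v. rim_pair c1 c2 c3 c4 c5 v" "\<exists>v. rim_pair c2 c3 c4 c5 c1 v"
    and none: "\<nexists>v. rim_pair c4 c5 c1 c2 c3 v" "\<nexists>v. rim_pair c5 c1 c2 c3 c4 v"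
  shows False
proof -
  obtain t1 t2 where t: "rim_pair c1 c2 c3 c4 c5 t1" "rim_pair c2 c3 c4 c5 c1 t2"
    using ex by blast
  note w = wheel_adj[OF wheel]
  note w2 = wheel_rotate[OF wheel]
  note w3 = wheel_rotate[OF w2]
  have t12: "E t1 t2"
    using next_rim_pair_adj[OF wheel t] .
  have zt: "\<not> E z t1" "\<not> E z t2"
    using hub_rim_pair[OF wheel t(1)] hub_rim_pair[OF w2 t(2)] .
  have unique1: "v = t1" if "rim_pair c1 c2 c3 c4 c5 v" for v
  proof (rule ccontr)
    assume "v \<noteq> t1"
    then have v: "E v t1" "E v t2" "\<not> E v z"
      using same_rim_pair_adj[OF wheel that t(1)] next_rim_pair_adj[OF wheel that t(2)]
        hub_rim_pair[OF wheel that] adj_sym by auto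
    have "hole5 c1 t1 t2 c3 z"
      using w rim_pair_adj[OF t(1)] rim_pair_adj[OF t(2)] t12 zt by (auto simp: hole5_def adj_commute)
    then show False
      using no_hole_plus_degree_3[of c1 t1 t2 c3 z v] v rim_pair_adj[OF that] by blast
  qed
  have unique2: "v = t2" if "rim_pair c2 c3 c4 c5 c1 v" for v
  proof (rule ccontr)
    assume "v \<noteq> t2"
    then have v: "E v t1" "E v t2" "\<not> E v z"
      using same_rim_pair_adj[OF w2 that t(2)] next_rim_pair_adj[OF wheel t(1) that]
        hub_rim_pair[OF w2 that] adj_sym by auto
    have "hole5 t1 t2 c3 z c1"
      using w rim_pair_adj[OF t(1)] rim_pair_adj[OF t(2)] t12 zt by (auto simp: hole5_def adj_commute)
    then show False
      using no_hole_plus_degree_3[of t1 t2 c3 z c1 v] v rim_pair_adj[OF that] by blast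
  qed
  have unique3: "v = t3" if "rim_pair c3 c4 c5 c1 c2 v" "rim_pair c3 c4 c5 c1 c2 t3" for v t3
  proof (rule ccontr)
    assume "v \<noteq> t3"
    then have v: "E v t2" "E v t3" "\<not> E v z"
      using same_rim_pair_adj[OF w3 that] next_rim_pair_adj[OF w2 t(2) that(1)]
        hub_rim_pair[OF w3 that(1)] adj_sym by auto
    have "hole5 t2 t3 c4 z c2"
      using w rim_pair_adj[OF that(2)] rim_pair_adj[OF t(2)] next_rim_pair_adj[OF w2 t(2) that(2)]
        zt hub_rim_pair[OF w3 that(2)] by (auto simp: hole5_def adj_commute)
    then show False
      using no_hole_plus_degree_3[of t2 t3 c4 z c2 v] v rim_pair_adj[OF that(1)] by blast
  qed
  have unique_hub: "v = z" if "wheel v c1 c2 c3 c4 c5" for v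
  proof (rule ccontr)
    assume "v \<noteq> z"
    have "\<not> E v t1" "\<not> E v t2"
      using hub_rim_pair[OF that t(1)] hub_rim_pair[OF wheel_rotate[OF that] t(2)] .
    moreover have "v \<noteq> t1" "z \<noteq> t1"
      using that wheel rim_pair_adj[OF t(1)] by (auto simp: wheel_def)
    ultimately have "E v z"
      using no_claw[of c1 t1 z v] \<open>v \<noteq> z\<close> w rim_pair_adj[OF t(1)] zt wheel_adj[OF that] adj_sym by blast
    have "hole5 c3 z c1 t1 t2"
      using w rim_pair_adj[OF t(1)] rim_pair_adj[OF t(2)] t12 zt by (auto simp: hole5_def adj_commute)
    then show False
      using no_hole_plus_degree_3[of c3 z c1 t1 t2 v] \<open>E v z\<close> \<open>\<not> E v t1\<close> \<open>\<not> E v t2\<close> wheel_adj[OF that]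
      by blast
  qed
  have not_c: "rim_pair c1 c2 c3 c4 c5 v \<or> rim_pair c2 c3 c4 c5 c1 v \<or> rim_pair c3 c4 c5 c1 c2 v \<Longrightarrow>
      v \<notin> {z, c1, c2, c3, c4, c5}" for v
    using w adj_irrefl by (auto simp: rim_pair_def)
  have univ: "v \<in> {z, c1, c2, c3, c4, c5, t1, t2} \<or> rim_pair c3 c4 c5 c1 c2 v" for v
    using wheel_classification[OF wheel, of v] no_far[of v] none unique1 unique2 unique_hub by blast
  have "t1 \<noteq> t2"
    using t12 adj_irrefl by blast
  then have dist: "distinct [z, c1, c2, c3, c4, c5, t1, t2]"
    using w(31) not_c[of t1] not_c[of t2] t by auto
  show False
  proof (cases "\<exists>t3. rim_pair c3 c4 c5 c1 c2 t3")
    case True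
    then obtain t3 where t3: "rim_pair c3 c4 c5 c1 c2 t3"
      by blast
    then have "t3 \<noteq> t1" "t3 \<noteq> t2"
      using rim_pair_adj[OF t(1)] rim_pair_adj[OF t(2)] by (auto simp: rim_pair_def)
    then have "distinct [z, c1, c2, c3, c4, c5, t1, t2, t3]"
      using dist not_c[of t3] t3 by auto
    moreover have "UNIV = set [z, c1, c2, c3, c4, c5, t1, t2, t3]"
      using univ unique3[OF _ t3] by auto
    ultimately show False
      using not_gear_chain wheel t t3 by blast
  next
    case False
    then have "UNIV = set [z, c1, c2, c3, c4, c5, t1, t2]"
      using univ by auto
    then show False
      using not_gear dist wheel t by blast
  qed
qed

lemma no_wheel: "\<not> wheel z c1 c2 c3 c4 c5"
proof
  assume w1: "wheel z c1 c2 c3 c4 c5"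
  note w2 = wheel_rotate[OF w1]
  note w3 = wheel_rotate[OF w2]
  note w4 = wheel_rotate[OF w3]
  note w5 = wheel_rotate[OF w4]
  let ?T1 = "rim_pair c1 c2 c3 c4 c5" and ?T2 = "rim_pair c2 c3 c4 c5 c1"
    and ?T3 = "rim_pair c3 c4 c5 c1 c2" and ?T4 = "rim_pair c4 c5 c1 c2 c3"
    and ?T5 = "rim_pair c5 c1 c2 c3 c4" and ?F = "far c1 c2 c3 c4 c5"
  show False
  proof (cases "\<exists>v. ?F v")
    case True
    then obtain f where f1: "?F f"
      by blast
    note f2 = far_rotate[OF f1]
    note f3 = far_rotate[OF f2]
    note f4 = far_rotate[OF f3]
    note f5 = far_rotate[OF f4]
    let ?K = "{t. ?T1 t \<or> ?T2 t \<or> ?T3 t \<or> ?T4 t \<or> ?T5 t}"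
    note apart = no_far_with_second_next_rim_pairs[OF w1 _ _ f1]
      no_far_with_second_next_rim_pairs[OF w2 _ _ f2] no_far_with_second_next_rim_pairs[OF w3 _ _ f3]
      no_far_with_second_next_rim_pairs[OF w4 _ _ f4] no_far_with_second_next_rim_pairs[OF w5 _ _ f5]
    note same = same_rim_pair_adj[OF w1] same_rim_pair_adj[OF w2] same_rim_pair_adj[OF w3]
      same_rim_pair_adj[OF w4] same_rim_pair_adj[OF w5]
    note "next" = next_rim_pair_adj[OF w1] next_rim_pair_adj[OF w2] next_rim_pair_adj[OF w3]
      next_rim_pair_adj[OF w4] next_rim_pair_adj[OF w5]
    note prev = "next"[THEN adj_sym]
    show False
    \<comment> \<open>With a far vertex present, any two occupied classes are equal or neighbouring,
      so the rim pairs form a clique; it separates the far vertices from the hub.\<close>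
    proof (rule no_clique_cutset[of "Collect ?F" ?K "- (Collect ?F \<union> ?K)"])
      show "Collect ?F \<inter> ?K = {}"
        by (auto simp: far_def rim_pair_def)
      show "Collect ?F \<noteq> {}"
        using f1 by blast
      have "z \<in> - (Collect ?F \<union> ?K)"
        using wheel_adj[OF w1] by (auto simp: far_def rim_pair_def)
      then show "- (Collect ?F \<union> ?K) \<noteq> {}"
        by blast
      show "clique E ?K"
        unfolding clique_def
      proof (intro ballI impI)
        fix t t'
        assume "t \<in> ?K" "t' \<in> ?K" "t \<noteq> t'"
        then show "E t t'"
          unfolding mem_Collect_eq
          by (elim disjE) (blast intro: same "next" prev dest: apart)+
      qed
      fix u v
      assume u: "u \<in> Collect ?F" and "v \<in> - (Collect ?F \<union> ?K)"
      then have "v \<in> {c1, c2, c3, c4, c5} \<or> wheel v c1 c2 c3 c4 c5"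
        using wheel_classification[OF w1, of v] by blast
      then show "\<not> E u v"
      proof
        assume "v \<in> {c1, c2, c3, c4, c5}"
        then show ?thesis
          using u by (auto simp: far_def)
      next
        assume "wheel v c1 c2 c3 c4 c5"
        then show ?thesis
          using u hub_far adj_sym by blast
      qed
    qed auto
  next
    case False
    then have F: "\<not> far c1 c2 c3 c4 c5 v" "\<not> far c2 c3 c4 c5 c1 v" "\<not> far c3 c4 c5 c1 c2 v"
      "\<not> far c4 c5 c1 c2 c3 v" "\<not> far c5 c1 c2 c3 c4 v" for v
      by (auto simp: far_def)
    \<comment> \<open>A nonempty set of classes on the 5-cycle with no isolated class and no four
      consecutive ones consists of two or three consecutive classes.\<close>
    note four = no_four_consecutive_rim_pairs[OF w1] no_four_consecutive_rim_pairs[OF w2]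
      no_four_consecutive_rim_pairs[OF w3] no_four_consecutive_rim_pairs[OF w4]
      no_four_consecutive_rim_pairs[OF w5]
    note isolated = isolated_rim_pair[OF w1 F(1)] isolated_rim_pair[OF w2 F(2)]
      isolated_rim_pair[OF w3 F(3)] isolated_rim_pair[OF w4 F(4)] isolated_rim_pair[OF w5 F(5)]
    note few = two_or_three_consecutive_rim_pairs[OF w1 F(1)]
      two_or_three_consecutive_rim_pairs[OF w2 F(2)] two_or_three_consecutive_rim_pairs[OF w3 F(3)]
      two_or_three_consecutive_rim_pairs[OF w4 F(4)] two_or_three_consecutive_rim_pairs[OF w5 F(5)]
    have "(\<exists>v. ?T1 v) \<or> (\<exists>v. ?T2 v) \<or> (\<exists>v. ?T3 v) \<or> (\<exists>v. ?T4 v) \<or> (\<exists>v. ?T5 v)"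
      using rim_pair_exists[OF w1] by blast
    then show False
      using four isolated few by argo
  qed
qed

theorem quasi_line: "quasi_line E"
proof (rule ccontr)
  assume "\<not> quasi_line E"
  then obtain z c1 c2 c3 c4 c5 where "hole5 c1 c2 c3 c4 c5"
    "E z c1" "E z c2" "E z c3" "E z c4" "E z c5"
    by (rule hole_in_neighborhood)
  then show False
    using no_wheel unfolding wheel_def by blast
qed

end

theorem theorem9:
  fixes E :: "'n::finite \<Rightarrow> 'n \<Rightarrow> bool"
  assumes "simple_graph E"
    and "claw_free E"
    and "\<not> quasi_line E"
    and "stability_number E = 3"
    and "facet_defining E"
  shows "\<not> LS_plus_perfect E"
proof
  assume "LS_plus_perfect E"
  obtain a :: "real^'n" and b where ab: "\<And>i. a $ i \<noteq> 0" "\<And>x. x \<in> STAB E \<Longrightarrow> a \<bullet> x \<le> b"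
    "(STAB E \<inter> {x. a \<bullet> x = b}) facet_of STAB E"
    using assms(5) unfolding facet_defining_def by blast
  have "2 \<le> CARD('n)"
  proof -
    have "finite {card S | S. stable_set E S}"
      by (rule finite_image_set) simp
    moreover have "card {} \<in> {card S | S. stable_set E S}"
      unfolding mem_Collect_eq by (intro exI[of _ "{}"]) (simp add: stable_set_def)
    ultimately have "3 \<in> {card S | S. stable_set E S}"
      using Max_in[of "{card S | S. stable_set E S}"] assms(4) unfolding stability_number_def by auto
    then obtain S :: "'n set" where "card S = 3"
      by auto
    then show ?thesis
      using card_mono[of UNIV S] by simp
  qed
  then interpret perfect_facet_graph E a b
    by unfold_locales (assumption | rule assms ab \<open>LS_plus_perfect E\<close>)+
  show False
    using quasi_line assms(3) by blast
qed

end
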